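(* Let $v$ be a valuation on $\mathcal{A}_1(\mathbb{R})$ with residue field $\mathbb{R}$ associated to a sequence $(\omega_i)_{i\ge -1}$, with $v(\omega_{i-1})=\frac{m_i}{n_i}$ and $\overline{x^{m_i}\omega_{i-1}^{n_i}}=\beta_i\in\mathbb{R}$ for $i\ge 1$, and let $\alpha_{i,j}\in\mathbb{R}$ and $h_i$ be the associated numbers defined in the context. Then $v$ can be extended to a valuation on $R[y;\delta]$ with the same residue field $\mathbb{R}$ only if the following conditions hold: (1) for each $i$ such that $n_i$ is even, $\beta_i>0$; and (2) for all $i,j,\ell$ with $h_i<h_j\le h_\ell$, $\alpha_{i,j}\alpha_{i,\ell}>0$.
   Context: A valuation on a division ring $D$ is a map $v:D\to\Gamma\cup\{\infty\}$, with $\Gamma$ an additively written totally ordered group and $\infty>\gamma$ for all $\gamma\in\Gamma$, such that $v(a)=\infty\iff a=0$, $v(ab)=v(a)+v(b)$ and $v(a+b)\ge\min\{v(a),v(b)\}$; $\overline{a}$ denotes the residue of an element $a$ with $v(a)\ge 0$. Valuations are trivial on $\mathbb{R}$, and "residue field $\mathbb{R}$" means that the natural map from $\mathbb{R}$ to the residue division ring is an isomorphism. A valuation on an Ore domain extends uniquely to its quotient division ring and is identified with this extension. $\mathcal{A}_1(\mathbb{R})$ is the $\mathbb{R}$-algebra generated by $x,y$ with $yx-xy=1$ and $\mathcal{D}_1(\mathbb{R})$ is its quotient division ring. $R=\{\sum_{k\ge m}a_kx^{-k/n}\mid a_k\in\mathbb{R},m\in\mathbb{Z},n\in\mathbb{N}\}$,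 $\delta(p(x))=p'(x)$, and $R[y;\delta]\supseteq\mathcal{A}_1(\mathbb{R})$ is the skew polynomial ring with $yp=py+\delta(p)$ for $p\in R$. Associated sequence: $v$ is normalized by $v(x)=-1$, and $\mathbb{Q}$ is identified with the rational multiples of $1=-v(x)$ in the divisible hull of the value group. Put $\omega_{-1}=x$, $\omega_0=y$. For $i\ge0$, as long as $v(\omega_i)\in\mathbb{Q}$, write $v(\omega_i)=\frac{m_{i+1}}{n_{i+1}}$ in lowest terms with $n_{i+1}>0$, let $\beta_{i+1}=\overline{x^{m_{i+1}}\omega_i^{n_{i+1}}}\in\mathbb{R}\setminus\{0\}$ and $\omega_{i+1}=x^{m_{i+1}}\omega_i^{n_{i+1}}-\beta_{i+1}$. The sequence is infinite, or it ends with $\omega_N$ if $v(\omega_N)\notin\mathbb{Q}$. Put also $m_0=1$, $n_0=-1$. For indices $i\ne j$, $i,j\ge 0$ (with $v(\omega_{i-1}),v(\omega_{j-1})\in\mathbb{Q}$), set $d_{i,j}=\gcd\{m_jn_i,m_in_j\}$, $K_{i,j}=\frac{m_jn_i}{d_{i,j}}$, $K_{j,i}=\frac{m_in_j}{d_{i,j}}$ and $\alpha_{i,j}=\overline{\omega_{i-1}^{K_{i,j}}\omega_{j-1}^{-K_{j,i}}}\in\mathbb{R}$; also $\alpha_{i,i}=1$. $2^{h_i}$ is the greatest power of two dividing $n_i$. All indices in (1) and (2) range over those for which these quantities are defined. *)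

theory Defs
  imports Complex_Main "HOL-Computational_Algebra.Computational_Algebra"
begin

section \<open>Valuations\<close>

class linordered_group_add = group_add + linorder +
  assumes group_add_left_mono: "a \<le> b \<Longrightarrow> c + a \<le> c + b"
    and group_add_right_mono: "a \<le> b \<Longrightarrow> a + c \<le> b + c"

subclass (in linordered_ab_group_add) linordered_group_add
  by unfold_locales (auto intro: add_left_mono add_right_mono)

datatype 'g ext_val = Val 'g | Infty

instantiation ext_val :: (zero) zero
begin
definition "0 = Val 0"
instance ..
end

instantiation ext_val :: (plus) plus
begin
fun plus_ext_val :: "'a ext_val \<Rightarrow> 'a ext_val \<Rightarrow> 'a ext_val" where
  "Val a + Val b = Val (a + b)"
| "Infty + b = Infty"
| "a + Infty = Infty"
instance ..
end

instantiation ext_val :: (linorder) linorder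
begin
fun less_eq_ext_val :: "'a ext_val \<Rightarrow> 'a ext_val \<Rightarrow> bool" where
  "a \<le> Infty \<longleftrightarrow> True"
| "Val a \<le> Val b \<longleftrightarrow> a \<le> b"
| "Infty \<le> Val b \<longleftrightarrow> False"
definition less_ext_val :: "'a ext_val \<Rightarrow> 'a ext_val \<Rightarrow> bool" where
  "(a::'a ext_val) < b \<longleftrightarrow> a \<le> b \<and> \<not> b \<le> a"
instance
proof
  fix x y z :: "'a ext_val"
  show "x < y \<longleftrightarrow> x \<le> y \<and> \<not> y \<le> x" by (rule less_ext_val_def)
  show "x \<le> x" by (cases x) auto
  show "x \<le> y \<Longrightarrow> y \<le> z \<Longrightarrow> x \<le> z" by (cases x; cases y; cases z) auto
  show "x \<le> y \<Longrightarrow> y \<le> x \<Longrightarrow> x = y" by (cases x; cases y) auto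
  show "x \<le> y \<or> y \<le> x" by (cases x; cases y) auto
qed
end

text \<open>Valuations are taken on a division subring \<open>K\<close> of an ambient division ring that
  contains a copy \<open>c\<close> of the real numbers; \<open>v\<close> is arbitrary outside \<open>K\<close>.\<close>

definition real_valuation_on ::
    "'d::division_ring set \<Rightarrow> (real \<Rightarrow> 'd) \<Rightarrow> ('d \<Rightarrow> 'g::linordered_group_add ext_val) \<Rightarrow> bool" where
  "real_valuation_on K c v \<longleftrightarrow>
     (\<forall>a\<in>K. v a = Infty \<longleftrightarrow> a = 0) \<and>
     (\<forall>a\<in>K. \<forall>b\<in>K. v (a * b) = v a + v b) \<and>
     (\<forall>a\<in>K. \<forall>b\<in>K. min (v a) (v b) \<le> v (a + b)) \<and>
     (\<forall>r. r \<noteq> 0 \<longrightarrow> v (c r) = 0)"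

definition residue_class ::
    "'d::division_ring set \<Rightarrow> ('d \<Rightarrow> 'g::linordered_group_add ext_val) \<Rightarrow> 'd \<Rightarrow> 'd set" where
  "residue_class K v a = {b \<in> K. 0 \<le> v b \<and> 0 < v (b - a)}"

definition residue_ring ::
    "'d::division_ring set \<Rightarrow> ('d \<Rightarrow> 'g::linordered_group_add ext_val) \<Rightarrow> 'd set set" where
  "residue_ring K v = residue_class K v ` {a \<in> K. 0 \<le> v a}"

text \<open>The natural map from the reals to the residue division ring is always a ring
  homomorphism, so it is an isomorphism if and only if it is bijective.\<close>

definition residue_field_real ::
    "'d::division_ring set \<Rightarrow> (real \<Rightarrow> 'd) \<Rightarrow> ('d \<Rightarrow> 'g::linordered_group_add ext_val) \<Rightarrow> bool" where
  "residue_field_real K c v \<longleftrightarrow>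
     bij_betw (\<lambda>r. residue_class K v (c r)) UNIV (residue_ring K v)"

definition residue ::
    "'d::division_ring set \<Rightarrow> (real \<Rightarrow> 'd) \<Rightarrow> ('d \<Rightarrow> 'g::linordered_group_add ext_val) \<Rightarrow> 'd \<Rightarrow> real" where
  "residue K c v a = (THE r. residue_class K v a = residue_class K v (c r))"

fun nat_mult :: "nat \<Rightarrow> 'g::group_add \<Rightarrow> 'g" where
  "nat_mult 0 g = 0"
| "nat_mult (Suc n) g = g + nat_mult n g"

definition int_mult :: "int \<Rightarrow> 'g::group_add \<Rightarrow> 'g" where
  "int_mult k g = (if 0 \<le> k then nat_mult (nat k) g else - nat_mult (nat (- k)) g)"

text \<open>\<open>v a = m / n\<close> in lowest terms, where \<open>1 = - v X\<close>. Roots are unique in a totally ordered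
  group, so this equation in the divisible hull amounts to \<open>n (v a) = m (- v X)\<close> in the value
  group itself.\<close>

definition lowest_terms_value ::
    "('d \<Rightarrow> 'g::linordered_group_add ext_val) \<Rightarrow> 'd \<Rightarrow> 'd \<Rightarrow> int \<Rightarrow> int \<Rightarrow> bool" where
  "lowest_terms_value v X a m n \<longleftrightarrow> 0 < n \<and> coprime m n \<and>
     (\<exists>g e. v a = Val g \<and> v X = Val e \<and> int_mult n g = int_mult m (- e))"


section \<open>Puiseux series in \<open>x\<^sup>-\<^sup>1\<close>\<close>

text \<open>\<open>f q\<close> is the coefficient of \<open>x\<close> to the power \<open>- q\<close>.\<close>

definition puiseux_series :: "(rat \<Rightarrow> real) \<Rightarrow> bool" where
  "puiseux_series f \<longleftrightarrow> (\<exists>(n::int) (m::int). 0 < n \<and>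
      (\<forall>q. f q \<noteq> 0 \<longrightarrow> (\<exists>k\<ge>m. q = of_int k / of_int n)))"

typedef puiseux = "{f. puiseux_series f}"
  morphisms coeff_at Abs_puiseux
  by (rule exI[of _ "\<lambda>_. 0"]) (auto simp: puiseux_series_def intro: exI[of _ 1])

setup_lifting type_definition_puiseux

definition conv :: "(rat \<Rightarrow> real) \<Rightarrow> (rat \<Rightarrow> real) \<Rightarrow> rat \<Rightarrow> real" where
  "conv f g q = (\<Sum>a | f a \<noteq> 0 \<and> g (q - a) \<noteq> 0. f a * g (q - a))"

lemma puiseux_series_common:
  assumes "puiseux_series f" "puiseux_series g"
  obtains n m :: int where "0 < n"
    "\<And>q. f q \<noteq> 0 \<Longrightarrow> \<exists>k\<ge>m. q = of_int k / of_int n"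
    "\<And>q. g q \<noteq> 0 \<Longrightarrow> \<exists>k\<ge>m. q = of_int k / of_int n"
proof -
  obtain n1 m1 :: int where 1: "0 < n1" "\<And>q. f q \<noteq> 0 \<Longrightarrow> \<exists>k\<ge>m1. q = of_int k / of_int n1"
    using assms(1) unfolding puiseux_series_def by blast
  obtain n2 m2 :: int where 2: "0 < n2" "\<And>q. g q \<noteq> 0 \<Longrightarrow> \<exists>k\<ge>m2. q = of_int k / of_int n2"
    using assms(2) unfolding puiseux_series_def by blast
  show thesis
  proof (rule that[of "n1 * n2" "min (m1 * n2) (m2 * n1)"])
    show "0 < n1 * n2" using 1 2 by simp
  next
    fix q assume "f q \<noteq> 0"
    then obtain k where k: "k \<ge> m1" "q = of_int k / of_int n1" using 1 by blast
    then have "m1 * n2 \<le> k * n2" "q = of_int (k * n2) / of_int (n1 * n2)" using 1(1) 2(1) by auto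
    then show "\<exists>k\<ge>min (m1 * n2) (m2 * n1). q = of_int k / of_int (n1 * n2)"
      by (intro exI[of _ "k * n2"]) auto
  next
    fix q assume "g q \<noteq> 0"
    then obtain k where k: "k \<ge> m2" "q = of_int k / of_int n2" using 2 by blast
    then have "m2 * n1 \<le> k * n1" "q = of_int (k * n1) / of_int (n1 * n2)" using 1(1) 2(1) by auto
    then show "\<exists>k\<ge>min (m1 * n2) (m2 * n1). q = of_int k / of_int (n1 * n2)"
      by (intro exI[of _ "k * n1"]) auto
  qed
qed

lemma puiseux_series_add: "puiseux_series f \<Longrightarrow> puiseux_series g \<Longrightarrow> puiseux_series (\<lambda>q. f q + g q)"
proof (erule (1) puiseux_series_common)
  fix n m :: int
  assume n: "0 < n"
    and f: "\<And>q. f q \<noteq> 0 \<Longrightarrow> \<exists>k\<ge>m. q = of_int k / of_int n"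
    and g: "\<And>q. g q \<noteq> 0 \<Longrightarrow> \<exists>k\<ge>m. q = of_int k / of_int n"
  have "\<exists>k\<ge>m. q = of_int k / of_int n" if q: "f q + g q \<noteq> 0" for q
    using f[of q] g[of q] q by fastforce
  with n show "puiseux_series (\<lambda>q. f q + g q)" unfolding puiseux_series_def by blast
qed

lemma puiseux_series_conv:
  assumes "puiseux_series f" "puiseux_series g"
  shows "puiseux_series (conv f g)"
proof -
  obtain n m :: int where nm: "0 < n"
    "\<And>q. f q \<noteq> 0 \<Longrightarrow> \<exists>k\<ge>m. q = of_int k / of_int n"
    "\<And>q. g q \<noteq> 0 \<Longrightarrow> \<exists>k\<ge>m. q = of_int k / of_int n"
    using puiseux_series_common[OF assms] by metis
  have "\<exists>k\<ge>2 * m. q = of_int k / of_int n" if q: "conv f g q \<noteq> 0" for q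
  proof -
    from q obtain a where "f a \<noteq> 0" "g (q - a) \<noteq> 0"
      unfolding conv_def using sum.neutral by (smt (verit) mem_Collect_eq)
    then obtain k l where "k \<ge> m" "a = of_int k / of_int n" "l \<ge> m" "q - a = of_int l / of_int n"
      using nm by meson
    then show ?thesis
      by (intro exI[of _ "k + l"]) (auto simp: add_divide_distrib algebra_simps)
  qed
  then show ?thesis using nm(1) unfolding puiseux_series_def by blast
qed

lemma puiseux_series_finite:
  assumes "puiseux_series f" shows "finite {q. f q \<noteq> 0 \<and> q \<le> u}"
proof -
  obtain n m :: int where nm: "0 < n" "\<And>q. f q \<noteq> 0 \<Longrightarrow> \<exists>k\<ge>m. q = of_int k / of_int n"
    using assms unfolding puiseux_series_def by blast
  have "{q. f q \<noteq> 0 \<and> q \<le> u} \<subseteq> (\<lambda>k. of_int k / of_int n) ` {m..\<lfloor>u * of_int n\<rfloor>}"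
  proof
    fix q assume q: "q \<in> {q. f q \<noteq> 0 \<and> q \<le> u}"
    then obtain k where k: "k \<ge> m" "q = of_int k / of_int n" using nm by blast
    have "of_int k \<le> u * of_int n" using q k nm(1) by (simp add: field_simps)
    then have "k \<le> \<lfloor>u * of_int n\<rfloor>" by (simp add: le_floor_iff)
    with k show "q \<in> (\<lambda>k. of_int k / of_int n) ` {m..\<lfloor>u * of_int n\<rfloor>}" by auto
  qed
  then show ?thesis by (rule finite_subset) auto
qed

lemma puiseux_series_lower:
  assumes "puiseux_series f" obtains l where "\<And>q. f q \<noteq> 0 \<Longrightarrow> l \<le> q"
proof -
  obtain n m :: int where nm: "0 < n" "\<And>q. f q \<noteq> 0 \<Longrightarrow> \<exists>k\<ge>m. q = of_int k / of_int n"
    using assms unfolding puiseux_series_def by blast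
  have "of_int m / of_int n \<le> q" if "f q \<noteq> 0" for q
    using nm(2)[OF that] nm(1) by (auto simp: divide_right_mono)
  then show ?thesis using that by blast
qed

lemma conv_finite:
  assumes "puiseux_series f" "puiseux_series g" shows "finite {a. f a \<noteq> 0 \<and> g (q - a) \<noteq> 0}"
proof -
  obtain l where l: "\<And>q. g q \<noteq> 0 \<Longrightarrow> l \<le> q" using puiseux_series_lower[OF assms(2)] by blast
  have "{a. f a \<noteq> 0 \<and> g (q - a) \<noteq> 0} \<subseteq> {a. f a \<noteq> 0 \<and> a \<le> q - l}"
    using l by (fastforce simp: algebra_simps)
  then show ?thesis using puiseux_series_finite[OF assms(1)] finite_subset by blast
qed

lemma conv_eq:
  assumes "finite A" "{a. f a \<noteq> 0 \<and> g (q - a) \<noteq> 0} \<subseteq> A"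
  shows "conv f g q = (\<Sum>a\<in>A. f a * g (q - a))"
  unfolding conv_def by (rule sum.mono_neutral_left) (use assms in auto)

lemma conv_commute: "conv f g = conv g f"
proof
  fix q
  show "conv f g q = conv g f q"
    unfolding conv_def
    by (rule sum.reindex_bij_witness[of _ "\<lambda>a. q - a" "\<lambda>a. q - a"]) auto
qed

lemma conv_assoc:
  assumes "puiseux_series f" "puiseux_series g" "puiseux_series h"
  shows "conv (conv f g) h = conv f (conv g h)"
proof
  fix q
  define T where "T = {(a, c). f a \<noteq> 0 \<and> h c \<noteq> 0 \<and> g (q - a - c) \<noteq> 0}"
  obtain lf where lf: "\<And>q. f q \<noteq> 0 \<Longrightarrow> lf \<le> q" using puiseux_series_lower[OF assms(1)] by blast
  obtain lg where lg: "\<And>q. g q \<noteq> 0 \<Longrightarrow> lg \<le> q" using puiseux_series_lower[OF assms(2)] by blast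
  obtain lh where lh: "\<And>q. h q \<noteq> 0 \<Longrightarrow> lh \<le> q" using puiseux_series_lower[OF assms(3)] by blast
  have "T \<subseteq> {a. f a \<noteq> 0 \<and> a \<le> q - lg - lh} \<times> {c. h c \<noteq> 0 \<and> c \<le> q - lg - lf}"
  proof
    fix p assume "p \<in> T"
    then obtain a c where p: "p = (a, c)" "f a \<noteq> 0" "h c \<noteq> 0" "g (q - a - c) \<noteq> 0"
      unfolding T_def by auto
    have "lf \<le> a" "lh \<le> c" "lg \<le> q - a - c" using p lf lg lh by auto
    then show "p \<in> {a. f a \<noteq> 0 \<and> a \<le> q - lg - lh} \<times> {c. h c \<noteq> 0 \<and> c \<le> q - lg - lf}"
      using p by (simp add: algebra_simps)
  qed
  then have T: "finite T"
    by (rule finite_subset) (simp add: puiseux_series_finite assms)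
  define A where "A = fst ` T"
  define C where "C = snd ` T"
  have fin: "finite A" "finite C" unfolding A_def C_def using T by auto
  have ex: "\<exists>a. F a \<noteq> 0 \<and> G (r - a) \<noteq> 0" if "conv F G r \<noteq> 0" for F G r
    using that unfolding conv_def using sum.neutral by (smt (verit) mem_Collect_eq)
  have inT: "a \<in> A \<and> c \<in> C" if "f a \<noteq> 0" "h c \<noteq> 0" "g (q - a - c) \<noteq> 0" for a c
    using that unfolding A_def C_def T_def by force
  have "conv (conv f g) h q = conv h (conv f g) q" by (simp add: conv_commute)
  also have "\<dots> = (\<Sum>c\<in>C. h c * conv f g (q - c))"
  proof (rule conv_eq[OF fin(2)], safe)
    fix c assume c: "h c \<noteq> 0" "conv f g (q - c) \<noteq> 0"
    from ex[OF c(2)] obtain a where "f a \<noteq> 0" "g (q - c - a) \<noteq> 0" by blast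
    then show "c \<in> C" using inT[of a c] c by (simp add: algebra_simps)
  qed
  also have "\<dots> = (\<Sum>c\<in>C. h c * (\<Sum>a\<in>A. f a * g (q - c - a)))"
  proof (rule sum.cong[OF refl])
    fix c assume "c \<in> C"
    then have c: "h c \<noteq> 0" unfolding C_def T_def by auto
    have "{a. f a \<noteq> 0 \<and> g (q - c - a) \<noteq> 0} \<subseteq> A"
      using inT[of _ c] c by (auto simp: algebra_simps)
    then show "h c * conv f g (q - c) = h c * (\<Sum>a\<in>A. f a * g (q - c - a))"
      by (simp add: conv_eq[OF fin(1)])
  qed
  also have "\<dots> = (\<Sum>a\<in>A. f a * (\<Sum>c\<in>C. h c * g (q - a - c)))"
    by (simp add: sum_distrib_left sum.swap[of _ C] algebra_simps)
  also have "\<dots> = (\<Sum>a\<in>A. f a * conv h g (q - a))"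
  proof (rule sum.cong[OF refl])
    fix a assume "a \<in> A"
    then have a: "f a \<noteq> 0" unfolding A_def T_def by auto
    have "{c. h c \<noteq> 0 \<and> g (q - a - c) \<noteq> 0} \<subseteq> C"
      using inT[of a] a by auto
    then show "f a * (\<Sum>c\<in>C. h c * g (q - a - c)) = f a * conv h g (q - a)"
      by (simp add: conv_eq[OF fin(2)])
  qed
  also have "\<dots> = conv f (conv h g) q"
  proof (rule conv_eq[OF fin(1), symmetric], safe)
    fix a assume a: "f a \<noteq> 0" "conv h g (q - a) \<noteq> 0"
    from ex[OF a(2)] obtain c where "h c \<noteq> 0" "g (q - a - c) \<noteq> 0" by blast
    then show "a \<in> A" using inT[of a c] a by simp
  qed
  also have "\<dots> = conv f (conv g h) q" by (simp add: conv_commute)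
  finally show "conv (conv f g) h q = conv f (conv g h) q" .
qed

lemma conv_add:
  assumes "puiseux_series f" "puiseux_series g" "puiseux_series h"
  shows "conv (\<lambda>q. f q + g q) h = (\<lambda>q. conv f h q + conv g h q)"
proof
  fix q
  let ?A = "{a. f a \<noteq> 0 \<and> h (q - a) \<noteq> 0} \<union> {a. g a \<noteq> 0 \<and> h (q - a) \<noteq> 0}"
  have A: "finite ?A" using conv_finite assms by blast
  have "conv (\<lambda>q. f q + g q) h q = (\<Sum>a\<in>?A. (f a + g a) * h (q - a))"
    by (rule conv_eq[OF A]) auto
  moreover have "conv f h q = (\<Sum>a\<in>?A. f a * h (q - a))" by (rule conv_eq[OF A]) auto
  moreover have "conv g h q = (\<Sum>a\<in>?A. g a * h (q - a))" by (rule conv_eq[OF A]) auto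
  ultimately show "conv (\<lambda>q. f q + g q) h q = conv f h q + conv g h q"
    by (simp add: sum.distrib algebra_simps)
qed

lemma conv_single: "conv (\<lambda>q. if q = p then r else 0) g = (\<lambda>q. r * g (q - p))"
proof
  fix q
  show "conv (\<lambda>q. if q = p then r else 0) g q = r * g (q - p)"
    by (subst conv_eq[of "{p}"]) auto
qed

lemma puiseux_series_single: "puiseux_series (\<lambda>q. if q = p then r else 0)"
proof -
  obtain a b :: int where "b > 0" "p = of_int a / of_int b"
    by (metis quotient_of_denom_pos quotient_of_div surj_pair)
  then show ?thesis unfolding puiseux_series_def by auto
qed

instantiation puiseux :: comm_ring_1
begin

lift_definition zero_puiseux :: puiseux is "\<lambda>_. 0"
  by (auto simp: puiseux_series_def intro: exI[of _ 1])

lift_definition one_puiseux :: puiseux is "\<lambda>q. if q = 0 then 1 else 0"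
  by (rule puiseux_series_single)

lift_definition plus_puiseux :: "puiseux \<Rightarrow> puiseux \<Rightarrow> puiseux" is "\<lambda>f g q. f q + g q"
  by (rule puiseux_series_add)

lift_definition uminus_puiseux :: "puiseux \<Rightarrow> puiseux" is "\<lambda>f q. - f q"
  by (simp add: puiseux_series_def)

lift_definition times_puiseux :: "puiseux \<Rightarrow> puiseux \<Rightarrow> puiseux" is conv
  by (rule puiseux_series_conv)

definition minus_puiseux :: "puiseux \<Rightarrow> puiseux \<Rightarrow> puiseux" where
  "minus_puiseux f g = f + - g"

instance
proof
  fix a b c :: puiseux
  show "a + b + c = a + (b + c)" by transfer (simp add: add.assoc)
  show "a + b = b + a" by transfer (simp add: add.commute)
  show "0 + a = a" by transfer simp
  show "- a + a = 0" by transfer simp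
  show "a - b = a + - b" by (rule minus_puiseux_def)
  show "a * b * c = a * (b * c)" by transfer (rule conv_assoc)
  show "a * b = b * a" by transfer (rule conv_commute)
  show "1 * a = a" by transfer (simp add: conv_single)
  show "(a + b) * c = a * c + b * c" by transfer (rule conv_add)
  show "(0::puiseux) \<noteq> 1" by transfer (metis zero_neq_one)
qed

end

lift_definition puiseux_monom :: "rat \<Rightarrow> real \<Rightarrow> puiseux" is "\<lambda>p r q. if q = p then r else 0"
  by (rule puiseux_series_single)

text \<open>\<open>\<delta>\<close> sends \<open>x\<close> to the power \<open>- q\<close> to \<open>- q\<close> times \<open>x\<close> to the power \<open>- q - 1\<close>.\<close>

lift_definition puiseux_deriv :: "puiseux \<Rightarrow> puiseux" is
  "\<lambda>f q. - of_rat (q - 1) * f (q - 1)"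
proof -
  fix f :: "rat \<Rightarrow> real"
  assume "puiseux_series f"
  then obtain n m :: int where nm: "0 < n" "\<And>q. f q \<noteq> 0 \<Longrightarrow> \<exists>k\<ge>m. q = of_int k / of_int n"
    unfolding puiseux_series_def by blast
  have "\<exists>k\<ge>m + n. q = of_int k / of_int n" if q: "f (q - 1) \<noteq> 0" for q
  proof -
    obtain k where "k \<ge> m" "q - 1 = of_int k / of_int n" using nm(2)[OF q] by blast
    then show ?thesis using nm(1)
      by (intro exI[of _ "k + n"]) (auto simp: add_divide_distrib algebra_simps)
  qed
  then show "puiseux_series (\<lambda>q. - of_rat (q - 1) * f (q - 1))"
    unfolding puiseux_series_def using nm(1) by (intro exI[of _ n] exI[of _ "m + n"]) auto
qed


section \<open>Skew polynomials over a commutative differential ring\<close>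

class diff_ring = comm_ring_1 +
  fixes derivation :: "'a \<Rightarrow> 'a"
  assumes derivation_add: "derivation (a + b) = derivation a + derivation b"
    and derivation_mult: "derivation (a * b) = derivation a * b + a * derivation b"
begin

lemma derivation_0 [simp]: "derivation 0 = 0"
  using derivation_add[of 0 0] by simp

lemma derivation_1 [simp]: "derivation 1 = 0"
  using derivation_mult[of 1 1] by simp

end

instantiation puiseux :: diff_ring
begin

definition derivation_puiseux :: "puiseux \<Rightarrow> puiseux" where
  "derivation_puiseux = puiseux_deriv"

instance
proof
  fix a b :: puiseux
  show "derivation (a + b) = derivation a + derivation b"
    unfolding derivation_puiseux_def by transfer (simp add: algebra_simps fun_eq_iff)
  show "derivation (a * b) = derivation a * b + a * derivation b"
    unfolding derivation_puiseux_def
  proof transfer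
    fix f g :: "rat \<Rightarrow> real"
    let ?D = "\<lambda>(f::rat \<Rightarrow> real) q. - of_rat (q - 1) * f (q - 1)"
    assume pf: "puiseux_series f" "puiseux_series g"
    show "?D (conv f g) = (\<lambda>q. conv (?D f) g q + conv f (?D g) q)"
    proof
      fix q
      define A where "A = {a. f a \<noteq> 0 \<and> g (q - 1 - a) \<noteq> 0}"
      have A: "finite A" unfolding A_def by (rule conv_finite[OF pf])
      have 1: "conv f g (q - 1) = (\<Sum>a\<in>A. f a * g (q - 1 - a))"
        by (rule conv_eq[OF A]) (simp add: A_def)
      have 2: "conv f (?D g) q = (\<Sum>a\<in>A. f a * ?D g (q - a))"
        by (rule conv_eq[OF A]) (auto simp: A_def algebra_simps)
      have "conv (?D f) g q = (\<Sum>a\<in>(\<lambda>a. a + 1) ` A. ?D f a * g (q - a))"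
      proof (rule conv_eq, simp add: A, safe)
        fix a assume "?D f a \<noteq> 0" "g (q - a) \<noteq> 0"
        then have "a - 1 \<in> A" by (simp add: A_def algebra_simps)
        then show "a \<in> (\<lambda>a. a + 1) ` A" by force
      qed
      also have "\<dots> = (\<Sum>a\<in>A. - of_rat a * f a * g (q - 1 - a))"
        by (subst sum.reindex) (auto simp: inj_on_def of_rat_add algebra_simps)
      finally have 3: "conv (?D f) g q = (\<Sum>a\<in>A. - of_rat a * f a * g (q - 1 - a))" .
      have 4: "q - a - 1 = q - 1 - a" for a :: rat by simp
      show "?D (conv f g) q = conv (?D f) g q + conv f (?D g) q"
        unfolding 1 2 3 sum_distrib_left sum.distrib[symmetric] 4
        by (rule sum.cong) (auto simp: ring_distribs of_rat_diff mult_ac)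
    qed
  qed
qed

end

text \<open>A skew polynomial is a polynomial in \<open>y\<close> with coefficients written on the left.\<close>

typedef (overloaded) 'a skew_poly = "UNIV :: 'a::diff_ring poly set"
  morphisms left_coeffs Skew ..

setup_lifting type_definition_skew_poly

definition left_mult_y :: "'a::diff_ring poly \<Rightarrow> 'a poly" where
  "left_mult_y q = pCons 0 q + map_poly derivation q"

definition skew_mult :: "'a::diff_ring poly \<Rightarrow> 'a poly \<Rightarrow> 'a poly" where
  "skew_mult p q = (\<Sum>i\<le>degree p. smult (coeff p i) ((left_mult_y ^^ i) q))"

lemma left_mult_y_add: "left_mult_y (p + q) = left_mult_y p + left_mult_y q"
  unfolding left_mult_y_def
  by (intro poly_eqI) (simp add: coeff_map_poly derivation_add coeff_pCons split: nat.split)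

lemma left_mult_y_0 [simp]: "left_mult_y 0 = 0"
  by (simp add: left_mult_y_def)

lemma left_mult_y_smult:
  "left_mult_y (smult a p) = smult a (left_mult_y p) + smult (derivation a) p"
  unfolding left_mult_y_def
  by (intro poly_eqI)
    (simp add: coeff_map_poly derivation_mult coeff_pCons algebra_simps split: nat.split)

lemma funpow_left_mult_y_add:
  "(left_mult_y ^^ i) (p + q) = (left_mult_y ^^ i) p + (left_mult_y ^^ i) q"
  by (induction i) (auto simp: left_mult_y_add)

lemma skew_mult_eq:
  assumes "degree p \<le> n"
  shows "skew_mult p q = (\<Sum>i\<le>n. smult (coeff p i) ((left_mult_y ^^ i) q))"
  unfolding skew_mult_def
  by (rule sum.mono_neutral_left) (use assms in \<open>auto simp: coeff_eq_0\<close>)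

lemma skew_mult_add_left: "skew_mult (p + p') q = skew_mult p q + skew_mult p' q"
proof -
  define n where "n = max (degree p) (degree p')"
  have "degree p \<le> n" "degree p' \<le> n" "degree (p + p') \<le> n"
    unfolding n_def by (auto intro: degree_add_le)
  then show ?thesis
    by (simp only: skew_mult_eq coeff_add smult_add_left sum.distrib)
qed

lemma skew_mult_add_right: "skew_mult p (q + q') = skew_mult p q + skew_mult p q'"
  by (simp add: skew_mult_def funpow_left_mult_y_add smult_add_right sum.distrib)

lemma skew_mult_smult: "skew_mult (smult a p) q = smult a (skew_mult p q)"
proof -
  have "smult a (\<Sum>i\<in>A. f i) = (\<Sum>i\<in>A. smult a (f i))" for f :: "nat \<Rightarrow> 'a poly" and A
    by (induction A rule: infinite_finite_induct) (auto simp: smult_add_right)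
  then show ?thesis
    by (subst skew_mult_eq[OF degree_smult_le]) (simp add: skew_mult_def)
qed

lemma skew_mult_pCons: "skew_mult (pCons a p) q = smult a q + skew_mult p (left_mult_y q)"
proof -
  have "skew_mult (pCons a p) q
      = (\<Sum>i\<le>Suc (degree p). smult (coeff (pCons a p) i) ((left_mult_y ^^ i) q))"
    by (rule skew_mult_eq) (simp add: degree_pCons_le)
  also have "\<dots> = smult a q
      + (\<Sum>i\<le>degree p. smult (coeff p i) ((left_mult_y ^^ i) (left_mult_y q)))"
    by (subst sum.atMost_Suc_shift) (simp add: funpow_swap1)
  finally show ?thesis by (simp add: skew_mult_def)
qed

lemma skew_mult_0_left [simp]: "skew_mult 0 q = 0"
  by (simp add: skew_mult_def)

lemma skew_mult_left_mult_y: "skew_mult (left_mult_y p) q = left_mult_y (skew_mult p q)"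
proof (induction p arbitrary: q)
  case 0
  then show ?case by simp
next
  case (pCons a p)
  have *: "left_mult_y (pCons a p) = pCons (derivation a) ([:a:] + left_mult_y p)"
    unfolding left_mult_y_def
    by (intro poly_eqI) (simp add: map_poly_pCons coeff_pCons coeff_map_poly split: nat.split)
  show ?case
    unfolding * skew_mult_pCons skew_mult_add_left
    by (simp add: skew_mult_pCons pCons.IH left_mult_y_add left_mult_y_smult algebra_simps)
qed

lemma skew_mult_assoc: "skew_mult (skew_mult p q) r = skew_mult p (skew_mult q r)"
proof (induction p arbitrary: q)
  case 0
  then show ?case by simp
next
  case (pCons a p)
  then show ?case
    by (simp add: skew_mult_pCons skew_mult_add_left skew_mult_smult skew_mult_left_mult_y)
qed

lemma skew_mult_1_left: "skew_mult 1 q = q"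
  by (simp add: skew_mult_def)

lemma skew_mult_1_right: "skew_mult p 1 = p"
proof -
  have "(left_mult_y ^^ i) 1 = monom (1::'a) i" for i
  proof (induction i)
    case 0
    then show ?case by simp
  next
    case (Suc i)
    have "map_poly derivation (monom (1::'a) i) = 0"
      by (intro poly_eqI) (simp add: coeff_map_poly)
    with Suc show ?case by (simp add: left_mult_y_def monom_Suc)
  qed
  then show ?thesis
    using poly_as_sum_of_monoms[of p] by (simp add: skew_mult_def smult_monom)
qed

instantiation skew_poly :: (diff_ring) ring_1
begin

lift_definition zero_skew_poly :: "'a skew_poly" is 0 .
lift_definition one_skew_poly :: "'a skew_poly" is 1 .
lift_definition plus_skew_poly :: "'a skew_poly \<Rightarrow> 'a skew_poly \<Rightarrow> 'a skew_poly" is "(+)" .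
lift_definition minus_skew_poly :: "'a skew_poly \<Rightarrow> 'a skew_poly \<Rightarrow> 'a skew_poly" is "(-)" .
lift_definition uminus_skew_poly :: "'a skew_poly \<Rightarrow> 'a skew_poly" is uminus .
lift_definition times_skew_poly :: "'a skew_poly \<Rightarrow> 'a skew_poly \<Rightarrow> 'a skew_poly" is skew_mult .

instance
proof
  fix a b c :: "'a skew_poly"
  show "a + b + c = a + (b + c)" by transfer (rule add.assoc)
  show "a + b = b + a" by transfer (rule add.commute)
  show "0 + a = a" by transfer simp
  show "- a + a = 0" by transfer simp
  show "a - b = a + - b" by transfer simp
  show "a * b * c = a * (b * c)" by transfer (rule skew_mult_assoc)
  show "1 * a = a" by transfer (rule skew_mult_1_left)
  show "a * 1 = a" by transfer (rule skew_mult_1_right)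
  show "(a + b) * c = a * c + b * c" by transfer (rule skew_mult_add_left)
  show "a * (b + c) = a * b + a * c" by transfer (rule skew_mult_add_right)
  show "(0::'a skew_poly) \<noteq> 1" by transfer simp
qed

end

lift_definition skew_const :: "'a::diff_ring \<Rightarrow> 'a skew_poly" is "\<lambda>p. [:p:]" .

lift_definition skew_y :: "'a::diff_ring skew_poly" is "[:0, 1:]" .

lemma skew_y_commute: "skew_y * skew_const p = skew_const p * skew_y + skew_const (derivation p)"
  by transfer (simp add: skew_mult_pCons left_mult_y_def map_poly_pCons)

lemma skew_const_add: "skew_const (p + q) = skew_const p + skew_const q"
  by transfer simp

lemma skew_const_mult: "skew_const (p * q) = skew_const p * skew_const q"
  by transfer (simp add: skew_mult_pCons)


section \<open>The Weyl algebra and quotient division rings\<close>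

definition real_const :: "real \<Rightarrow> puiseux skew_poly" where
  "real_const r = skew_const (puiseux_monom 0 r)"

definition x_elem :: "puiseux skew_poly" where
  "x_elem = skew_const (puiseux_monom (- 1) 1)"

text \<open>The subalgebra generated by \<open>x\<close> and \<open>y\<close>. As the Weyl algebra over the reals is simple,
  the relation \<open>weyl_relation\<close> below shows that this is a copy of it.\<close>

inductive_set weyl_algebra :: "puiseux skew_poly set" where
  const: "real_const r \<in> weyl_algebra"
| x: "x_elem \<in> weyl_algebra"
| y: "skew_y \<in> weyl_algebra"
| add: "a \<in> weyl_algebra \<Longrightarrow> b \<in> weyl_algebra \<Longrightarrow> a + b \<in> weyl_algebra"
| mult: "a \<in> weyl_algebra \<Longrightarrow> b \<in> weyl_algebra \<Longrightarrow> a * b \<in> weyl_algebra"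

lemma weyl_relation: "skew_y * x_elem - x_elem * skew_y = 1"
proof -
  have "derivation (puiseux_monom (- 1) 1) = 1"
    unfolding derivation_puiseux_def by transfer (auto simp: fun_eq_iff)
  moreover have "skew_const (1::puiseux) = 1" by transfer (simp add: one_pCons)
  ultimately show ?thesis by (simp add: x_elem_def skew_y_commute)
qed

definition is_quotient_division_ring :: "('a::ring_1 \<Rightarrow> 'd::division_ring) \<Rightarrow> bool" where
  "is_quotient_division_ring \<iota> \<longleftrightarrow>
     inj \<iota> \<and> \<iota> 1 = 1 \<and>
     (\<forall>a b. \<iota> (a + b) = \<iota> a + \<iota> b) \<and> (\<forall>a b. \<iota> (a * b) = \<iota> a * \<iota> b) \<and>
     (\<forall>z. \<exists>a b. b \<noteq> 0 \<and> z = \<iota> a * inverse (\<iota> b))"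

text \<open>The quotient division ring of the Weyl algebra, inside that of the skew polynomial
  ring.\<close>

definition weyl_quotient :: "(puiseux skew_poly \<Rightarrow> 'd::division_ring) \<Rightarrow> 'd set" where
  "weyl_quotient \<iota> =
     {\<iota> a * inverse (\<iota> b) | a b. a \<in> weyl_algebra \<and> b \<in> weyl_algebra \<and> b \<noteq> 0}"


section \<open>The associated sequence\<close>

context
  fixes \<iota> :: "puiseux skew_poly \<Rightarrow> 'd::division_ring"
    and v :: "'d \<Rightarrow> 'g::linordered_group_add ext_val"
begin

definition X :: 'd where "X = \<iota> x_elem"

definition res :: "'d \<Rightarrow> real" where
  "res = residue (weyl_quotient \<iota>) (\<lambda>r. \<iota> (real_const r)) v"

definition rational_value :: "'d \<Rightarrow> bool" where
  "rational_value a \<longleftrightarrow> (\<exists>m n. lowest_terms_value v X a m n)"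

definition value_num :: "'d \<Rightarrow> int" where
  "value_num a = (THE m. \<exists>n. lowest_terms_value v X a m n)"

definition value_den :: "'d \<Rightarrow> int" where
  "value_den a = (THE n. \<exists>m. lowest_terms_value v X a m n)"

definition unit_of :: "'d \<Rightarrow> 'd" where
  "unit_of a = X powi value_num a * a powi value_den a"

text \<open>Indices are shifted by one: \<open>omega i\<close> is \<open>\<omega>\<^sub>i\<^sub>-\<^sub>1\<close>, so that its value is
  \<open>num i / den i\<close>. All of these functions are meaningful only at indices satisfying
  \<open>in_range\<close> below.\<close>

fun omega :: "nat \<Rightarrow> 'd" where
  "omega 0 = X"
| "omega (Suc 0) = \<iota> skew_y"
| "omega (Suc (Suc i)) =
     unit_of (omega (Suc i)) - \<iota> (real_const (res (unit_of (omega (Suc i)))))"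

definition in_range :: "nat \<Rightarrow> bool" where
  "in_range i \<longleftrightarrow> (\<forall>k\<le>i. rational_value (omega k))"

definition num :: "nat \<Rightarrow> int" where
  "num i = (if i = 0 then 1 else value_num (omega i))"

definition den :: "nat \<Rightarrow> int" where
  "den i = (if i = 0 then - 1 else value_den (omega i))"

definition beta :: "nat \<Rightarrow> real" where
  "beta i = res (X powi num i * omega i powi den i)"

text \<open>The gcd vanishes only if \<open>num i = num j = 0\<close>, in which case \<open>den i = den j = 1\<close>.\<close>

definition K_exp :: "nat \<Rightarrow> nat \<Rightarrow> int" where
  "K_exp i j = (num j * den i) div gcd (num j * den i) (num i * den j)"

definition alpha :: "nat \<Rightarrow> nat \<Rightarrow> real" where
  "alpha i j =
     (if i = j then 1 else res (omega i powi K_exp i j * omega j powi (- K_exp j i)))"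

definition two_exp :: "nat \<Rightarrow> nat" where
  "two_exp i = multiplicity 2 (den i)"

end

end

theory Submission
  imports Defs
begin

text \<open>The Puiseux monomials \<open>x\<^sup>q\<close> supply roots of \<open>x\<close>, so in the larger division ring every element
  of rational value is \<open>x\<^sup>q u\<close> with \<open>u\<close> a unit, whose residue \<open>r\<close> is a nonzero real number.
  Conjugation by \<open>x\<^sup>q\<close> fixes the reals and hence acts trivially on the residue field, so
  \<open>(q, r)\<close> is multiplicative in the element. If \<open>r\<^sub>i\<close> is the residue belonging to \<open>\<omega>\<^sub>i\<^sub>-\<^sub>1\<close>, then
  \<open>\<beta>\<^sub>i\<close> is the \<open>n\<^sub>i\<close>-th power of \<open>r\<^sub>i\<close>, and \<open>\<alpha>\<^sub>i\<^sub>j\<close> is the product of \<open>r\<^sub>i\<close> and \<open>r\<^sub>j\<close> to the powers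
  \<open>K\<^sub>i\<^sub>j\<close> and \<open>-K\<^sub>j\<^sub>i\<close>; for \<open>h\<^sub>i < h\<^sub>j\<close> the first exponent is odd and the second even, so
  \<open>\<alpha>\<^sub>i\<^sub>j\<close> has the sign of \<open>r\<^sub>i\<close>.\<close>

section \<open>The Ore condition for the Weyl algebra\<close>

lemma funpow_left_mult_y_top:
  assumes "degree p \<le> m"
  shows "degree ((left_mult_y ^^ i) p) \<le> m + i" "coeff ((left_mult_y ^^ i) p) (m + i) = coeff p m"
proof -
  have "degree ((left_mult_y ^^ i) p) \<le> m + i \<and> coeff ((left_mult_y ^^ i) p) (m + i) = coeff p m"
  proof (induction i)
    case 0
    then show ?case using assms by simp
  next
    case (Suc i)
    let ?q = "(left_mult_y ^^ i) p"
    have high: "coeff ?q k = 0" if "m + i < k" for k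
      using Suc that by (intro coeff_eq_0) auto
    have step: "coeff (left_mult_y ?q) (Suc k) = coeff ?q k + derivation (coeff ?q (Suc k))" for k
      by (simp add: left_mult_y_def coeff_map_poly)
    have "coeff (left_mult_y ?q) k = 0" if k: "m + Suc i < k" for k
    proof -
      obtain k' where "k = Suc k'" using k by (cases k) auto
      then show ?thesis using k by (simp add: step high)
    qed
    \<comment> \<open>At the top position \<open>derivation\<close> is applied to the coefficient
      just above the degree bound, which is zero, so only the shifted coefficient survives.\<close>
    then have "degree (left_mult_y ?q) \<le> m + Suc i" by (intro degree_le) auto
    moreover have "coeff (left_mult_y ?q) (m + Suc i) = coeff p m"
      using Suc by (simp add: step high)
    ultimately show ?case by simp
  qed
  then show "degree ((left_mult_y ^^ i) p) \<le> m + i"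
    "coeff ((left_mult_y ^^ i) p) (m + i) = coeff p m" by auto
qed

text \<open>Only the summand \<open>i = n\<close> reaches degree \<open>n + m\<close>, so at the top
  the skew product behaves like the commutative one. Degree bounds instead of exact degrees leave
  room for vanishing top coefficients.\<close>

lemma skew_mult_top:
  assumes "degree p \<le> n" "degree q \<le> m"
  shows "degree (skew_mult p q) \<le> n + m" "coeff (skew_mult p q) (n + m) = coeff p n * coeff q m"
proof -
  let ?t = "\<lambda>i. smult (coeff p i) ((left_mult_y ^^ i) q)"
  have eq: "skew_mult p q = (\<Sum>i\<le>n. ?t i)" by (rule skew_mult_eq[OF assms(1)])
  have deg: "degree (?t i) \<le> m + i" for i
    using funpow_left_mult_y_top(1)[OF assms(2)] degree_smult_le le_trans by blast
  have "degree (?t i) \<le> n + m" if "i \<le> n" for i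
    using deg[of i] that by linarith
  then show "degree (skew_mult p q) \<le> n + m"
    unfolding eq by (intro degree_sum_le) auto
  have "coeff (?t i) (n + m) = 0" if "i < n" for i
    using deg[of i] that by (intro coeff_eq_0) simp
  then have "coeff (skew_mult p q) (n + m) = (\<Sum>i\<in>{n}. coeff (?t i) (n + m))"
    unfolding eq coeff_sum by (intro sum.mono_neutral_right) auto
  also have "\<dots> = coeff p n * coeff q m"
    using funpow_left_mult_y_top(2)[OF assms(2), of n] by (simp add: add.commute)
  finally show "coeff (skew_mult p q) (n + m) = coeff p n * coeff q m" .
qed

definition y_degree :: "'a::diff_ring skew_poly \<Rightarrow> nat" where
  "y_degree a = degree (left_coeffs a)"

definition y_coeff :: "'a::diff_ring skew_poly \<Rightarrow> nat \<Rightarrow> 'a" where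
  "y_coeff a = coeff (left_coeffs a)"

lemma y_coeff_diff: "y_coeff (a - b) k = y_coeff a k - y_coeff b k"
  by (simp add: y_coeff_def minus_skew_poly.rep_eq)

lemma y_coeff_mult_top:
  assumes "y_degree a \<le> n" "y_degree b \<le> m"
  shows "y_degree (a * b) \<le> n + m" "y_coeff (a * b) (n + m) = y_coeff a n * y_coeff b m"
  using skew_mult_top assms unfolding y_degree_def y_coeff_def times_skew_poly.rep_eq by auto

lemma y_degree_diff_le: "y_degree a \<le> n \<Longrightarrow> y_degree b \<le> n \<Longrightarrow> y_degree (a - b) \<le> n"
  by (simp add: y_degree_def minus_skew_poly.rep_eq degree_diff_le)

lemma y_coeff_degree_nonzero: "a \<noteq> 0 \<Longrightarrow> y_coeff a (y_degree a) \<noteq> 0"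
  by (simp add: y_coeff_def y_degree_def) (metis left_coeffs_inverse zero_skew_poly_def)

lemma skew_const_top: "y_degree (skew_const f) = 0" "y_coeff (skew_const f) 0 = f"
  by (simp_all add: y_degree_def y_coeff_def skew_const.rep_eq)

lemma skew_y_top: "y_degree (skew_y ^ k :: 'a::diff_ring skew_poly) \<le> k"
  "y_coeff (skew_y ^ k) k = (1::'a)"
proof -
  have "y_degree (skew_y ^ k :: 'a skew_poly) \<le> k \<and> y_coeff (skew_y ^ k) k = (1::'a)"
  proof (induction k)
    case 0
    then show ?case by (simp add: y_degree_def y_coeff_def one_skew_poly.rep_eq)
  next
    case (Suc k)
    have "y_degree (skew_y :: 'a skew_poly) \<le> 1" "y_coeff (skew_y :: 'a skew_poly) 1 = 1"
      by (simp_all add: y_degree_def y_coeff_def skew_y.rep_eq)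
    then show ?case using Suc y_coeff_mult_top[of "skew_y :: 'a skew_poly" 1 "skew_y ^ k" k] by auto
  qed
  then show "y_degree (skew_y ^ k :: 'a skew_poly) \<le> k" "y_coeff (skew_y ^ k) k = (1::'a)" by auto
qed

section \<open>Puiseux monomials and real constants\<close>

lemma skew_const_eq_0_iff [simp]: "skew_const f = 0 \<longleftrightarrow> f = 0"
  by transfer simp

lemma puiseux_monom_mult: "puiseux_monom p r * puiseux_monom q s = puiseux_monom (p + q) (r * s)"
  by transfer (auto simp: conv_single fun_eq_iff algebra_simps)

lemma puiseux_monom_add: "puiseux_monom p (r + s) = puiseux_monom p r + puiseux_monom p s"
  by transfer auto

lemma puiseux_monom_one: "puiseux_monom 0 1 = 1"
  by transfer auto

lemma skew_const_1: "skew_const 1 = 1"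
  by transfer (simp add: one_pCons)

lemma real_const_hom:
  "real_const (r + s) = real_const r + real_const s"
  "real_const (r * s) = real_const r * real_const s"
  "real_const 1 = 1" "real_const 0 = 0" "real_const (- r) = - real_const r"
proof -
  show add: "real_const (r + s) = real_const r + real_const s" for r s
    by (simp add: real_const_def puiseux_monom_add skew_const_add)
  show "real_const (r * s) = real_const r * real_const s"
    by (simp add: real_const_def puiseux_monom_mult flip: skew_const_mult)
  show "real_const 1 = 1" by (simp add: real_const_def puiseux_monom_one skew_const_1)
  show 0: "real_const 0 = 0" using add[of 0 0] by simp
  show "real_const (- r) = - real_const r"
    using add[of "- r" r] 0 by (simp add: eq_neg_iff_add_eq_0)
qed

section \<open>Closure properties of the Weyl algebra\<close>

lemma weyl_algebra_0: "0 \<in> weyl_algebra" and weyl_algebra_1: "1 \<in> weyl_algebra"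
  using weyl_algebra.const[of 0] weyl_algebra.const[of 1] by (simp_all add: real_const_hom)

lemma weyl_algebra_uminus: "a \<in> weyl_algebra \<Longrightarrow> - a \<in> weyl_algebra"
  using weyl_algebra.mult[OF weyl_algebra.const[of "- 1"], of a] by (simp add: real_const_hom)

lemma weyl_algebra_diff: "a \<in> weyl_algebra \<Longrightarrow> b \<in> weyl_algebra \<Longrightarrow> a - b \<in> weyl_algebra"
  using weyl_algebra.add[OF _ weyl_algebra_uminus, of a b] by simp

lemma weyl_algebra_y_power: "skew_y ^ k \<in> weyl_algebra"
  by (induction k) (auto intro: weyl_algebra.intros weyl_algebra_1)

lemma skew_const_0 [simp]: "skew_const 0 = 0" by simp

lemma weyl_algebra_derivation:
  assumes "skew_const f \<in> weyl_algebra"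
  shows "skew_const (derivation f) \<in> weyl_algebra"
proof -
  have "skew_const (derivation f) = skew_y * skew_const f - skew_const f * skew_y"
    by (simp add: skew_y_commute)
  then show ?thesis using assms by (auto intro: weyl_algebra.intros weyl_algebra_diff)
qed

text \<open>Makes the multipliers of pseudo-division available inside the Weyl algebra. The property
  is inherited by products because left multiplication by \<open>y\<close> only shifts and derives
  coefficients, and a derivative is a commutator with \<open>y\<close>.\<close>

lemma weyl_algebra_coeff:
  assumes "a \<in> weyl_algebra"
  shows "skew_const (y_coeff a k) \<in> weyl_algebra"
proof -
  define good where "good p \<longleftrightarrow> (\<forall>k. skew_const (coeff p k) \<in> weyl_algebra)" for p
  have good_const: "good [:f:]" if "skew_const f \<in> weyl_algebra" for f
    using that by (simp add: good_def coeff_pCons weyl_algebra_0 split: nat.split)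
  have good_add: "good (p + q)" if "good p" "good q" for p q
    using that by (auto simp: good_def skew_const_add intro: weyl_algebra.add)
  have good_smult: "good (smult f p)" if "skew_const f \<in> weyl_algebra" "good p" for f p
    using that by (auto simp: good_def skew_const_mult intro: weyl_algebra.mult)
  have good_y: "good (left_mult_y p)" if "good p" for p
    unfolding left_mult_y_def
    by (rule good_add)
      (use that in \<open>auto simp: good_def coeff_pCons coeff_map_poly weyl_algebra_0
        intro: weyl_algebra_derivation split: nat.split\<close>)
  have good_sum: "good (sum g I)" if "\<And>i. i \<in> I \<Longrightarrow> good (g i)" "finite I" for g and I :: "nat set"
    using that(2,1) by (induction I) (auto simp: good_def weyl_algebra_0 intro: weyl_algebra.add simp: skew_const_add)
  have good_mult: "good (skew_mult p q)" if "good p" "good q" for p q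
  proof -
    have "good ((left_mult_y ^^ i) q)" for i
      using that(2) by (induction i) (auto intro: good_y)
    then show ?thesis
      unfolding skew_mult_def using that(1)
      by (intro good_sum good_smult) (auto simp: good_def)
  qed
  have "good (left_coeffs a)"
    using assms
  proof induction
    case (const r)
    then show ?case
      using weyl_algebra.const[of r] good_const
      by (simp add: real_const_def skew_const.rep_eq)
  next
    case x
    then show ?case
      using weyl_algebra.x good_const by (simp add: x_elem_def skew_const.rep_eq)
  next
    case y
    then show ?case
      by (simp add: good_def skew_y.rep_eq coeff_pCons weyl_algebra_0 weyl_algebra_1 skew_const_1
          split: nat.split)
  qed (auto simp: plus_skew_poly.rep_eq times_skew_poly.rep_eq intro: good_add good_mult)
  then show ?thesis by (simp add: good_def y_coeff_def)
qed

text \<open>Multiplying each element on the right by the top coefficient of the other, together with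
  the power of \<open>y\<close> that levels the degrees, produces equal top coefficients, since the
  Puiseux coefficients commute.\<close>

lemma weyl_algebra_pseudo_division:
  assumes "a \<in> weyl_algebra" "b \<in> weyl_algebra" "b \<noteq> 0" "y_degree b \<le> y_degree a"
  obtains s t where "s \<in> weyl_algebra" "t \<in> weyl_algebra" "s \<noteq> 0"
    "a * s - b * t = 0 \<or> y_degree (a * s - b * t) < y_degree a"
proof -
  define f where "f = y_coeff a (y_degree a)"
  define g where "g = y_coeff b (y_degree b)"
  define k where "k = y_degree a - y_degree b"
  define s where "s = skew_const g"
  define t where "t = skew_const f * skew_y ^ k"
  have n: "y_degree a = y_degree b + k" using assms(4) by (simp add: k_def)
  have t: "y_degree t \<le> k" "y_coeff t k = f"
    using y_coeff_mult_top[of "skew_const f" 0 "skew_y ^ k" k]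
    by (simp_all add: t_def skew_const_top skew_y_top)
  have as: "y_degree (a * s) \<le> y_degree a" "y_coeff (a * s) (y_degree a) = f * g"
    using y_coeff_mult_top[of a "y_degree a" s 0] by (simp_all add: s_def skew_const_top f_def)
  have bt: "y_degree (b * t) \<le> y_degree a" "y_coeff (b * t) (y_degree a) = g * f"
    using y_coeff_mult_top[of b "y_degree b" t k] t by (simp_all add: n g_def)
  have "y_degree (a * s - b * t) \<le> y_degree a" using as bt by (simp add: y_degree_diff_le)
  moreover have "y_coeff (a * s - b * t) (y_degree a) = 0"
    using as bt by (simp add: y_coeff_diff mult.commute)
  ultimately have "a * s - b * t = 0 \<or> y_degree (a * s - b * t) < y_degree a"
    using y_coeff_degree_nonzero[of "a * s - b * t"] le_neq_implies_less by metis
  moreover have "s \<in> weyl_algebra" "t \<in> weyl_algebra" "s \<noteq> 0"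
    using assms weyl_algebra_coeff y_coeff_degree_nonzero
    by (auto simp: s_def t_def f_def g_def intro: weyl_algebra.mult weyl_algebra_y_power)
  ultimately show thesis using that by blast
qed

text \<open>Euclidean algorithm: the larger of the two elements is replaced by its pseudo-remainder.
  The assumption \<open>domain\<close> is later supplied by the embedding into a division
  ring.\<close>

lemma weyl_algebra_right_Ore:
  assumes domain: "\<And>a b :: puiseux skew_poly. a * b = 0 \<Longrightarrow> a = 0 \<or> b = 0"
    and "a \<in> weyl_algebra" "b \<in> weyl_algebra" "b \<noteq> 0"
  shows "\<exists>p\<in>weyl_algebra. \<exists>q\<in>weyl_algebra. p \<noteq> 0 \<and> a * p = b * q"
proof -
  \<comment> \<open>Zero is smaller than every nonzero constant, so a vanishing remainder counts as
    a descent even in degree 0.\<close>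
  define size :: "puiseux skew_poly \<Rightarrow> nat" where
    "size a = (if a = 0 then 0 else Suc (y_degree a))" for a
  show ?thesis
    using assms(2-4)
  proof (induction "size a + size b" arbitrary: a b rule: less_induct)
    case less
    show ?case
    proof (cases "a = 0")
      case True
      then show ?thesis
        by (intro bexI[of _ 1] bexI[of _ 0]) (auto simp: weyl_algebra_0 weyl_algebra_1)
    next
      case False
      \<comment> \<open>Only the total size of the pair is fixed, so that this applies to
        \<open>a\<close> and \<open>b\<close> in either order.\<close>
      have *: "\<exists>s\<in>weyl_algebra. \<exists>t\<in>weyl_algebra. s \<noteq> 0 \<and> a' * s = b' * t"
        if mem: "a' \<in> weyl_algebra" "b' \<in> weyl_algebra" "a' \<noteq> 0" "b' \<noteq> 0"
          and le: "y_degree b' \<le> y_degree a'" and sz: "size a' + size b' = size a + size b" for a' b'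
      proof -
        obtain s t where st: "s \<in> weyl_algebra" "t \<in> weyl_algebra" "s \<noteq> 0"
          "a' * s - b' * t = 0 \<or> y_degree (a' * s - b' * t) < y_degree a'"
          using weyl_algebra_pseudo_division[OF mem(1,2,4) le] by blast
        have "size (a' * s - b' * t) + size b' < size a + size b"
          using st(4) mem(3) unfolding sz[symmetric] by (auto simp: size_def)
        then obtain p q where pq: "p \<in> weyl_algebra" "q \<in> weyl_algebra" "p \<noteq> 0"
          "(a' * s - b' * t) * p = b' * q"
          using less(1)[of "a' * s - b' * t" b'] mem st
          by (auto intro: weyl_algebra.mult weyl_algebra_diff)
        have "a' * (s * p) = b' * (q + t * p)"
          using pq(4) by (simp add: algebra_simps)
        moreover have "s * p \<noteq> 0" using domain st(3) pq(3) by blast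
        ultimately show ?thesis using st pq by (meson weyl_algebra.add weyl_algebra.mult)
      qed
      show ?thesis
      proof (cases "y_degree b \<le> y_degree a")
        case True
        then show ?thesis using * less False by blast
      next
        case swap: False
        then obtain s t where st: "s \<in> weyl_algebra" "t \<in> weyl_algebra" "s \<noteq> 0" "b * s = a * t"
          using *[of b a] less(2-4) False by auto
        \<comment> \<open>With the roles exchanged, \<open>t\<close> becomes the multiplier of
          \<open>a\<close>; it is nonzero because \<open>b * s\<close> is.\<close>
        moreover have "t \<noteq> 0" using st domain less(4) by force
        ultimately show ?thesis by metis
      qed
    qed
  qed
qed


section \<open>Totally ordered groups\<close>

lemma group_add_strict_left_mono: "a < b \<Longrightarrow> c + a < c + (b::'g::linordered_group_add)"
  using group_add_left_mono[of a b c] by (auto simp: less_le)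

lemma group_add_strict_right_mono: "a < b \<Longrightarrow> a + c < b + (c::'g::linordered_group_add)"
  using group_add_right_mono[of a b c] by (auto simp: less_le)

text \<open>In a group that may be noncommutative, the summands are exchanged one at a time, using
  monotonicity on both sides. It yields the uniqueness of roots.\<close>

lemma nat_mult_strict_mono: "0 < n \<Longrightarrow> a < b \<Longrightarrow> nat_mult n a < nat_mult n (b::'g::linordered_group_add)"
proof (induction n)
  case (Suc n)
  then have "nat_mult n a \<le> nat_mult n b" by (cases n) (auto simp: less_imp_le)
  then have "a + nat_mult n a \<le> a + nat_mult n b" by (rule group_add_left_mono)
  also have "\<dots> < b + nat_mult n b" using Suc by (intro group_add_strict_right_mono)
  finally show ?case by simp
qed simp

lemma nat_mult_cancel: "0 < n \<Longrightarrow> nat_mult n a = nat_mult n b \<Longrightarrow> a = (b::'g::linordered_group_add)"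
  by (metis linorder_neq_iff nat_mult_strict_mono)

lemma int_mult_cancel: "0 < n \<Longrightarrow> int_mult n a = int_mult n b \<Longrightarrow> a = (b::'g::linordered_group_add)"
  using nat_mult_cancel[of "nat n"] by (simp add: int_mult_def)

lemma nat_mult_commutes: "nat_mult n g + g = g + nat_mult n (g::'g::group_add)"
  by (induction n) (auto simp: add.assoc)

lemma nat_mult_uminus: "nat_mult n (- g) = - nat_mult n (g::'g::group_add)"
proof (induction n)
  case (Suc n)
  then show ?case using nat_mult_commutes[of n g] by (metis minus_add nat_mult.simps(2))
qed simp

lemma int_mult_uminus: "int_mult k (- g) = int_mult (- k) (g::'g::group_add)"
  by (cases "k = 0") (auto simp: int_mult_def nat_mult_uminus)

section \<open>The value group with an infinite element\<close>

lemma Val_less_iff [simp]: "Val a < Val b \<longleftrightarrow> a < b"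
  by (auto simp: less_ext_val_def)

lemma Val_less_Infty [simp]: "Val a < Infty"
  by (simp add: less_ext_val_def)

lemma ext_val_zero_add [simp]: "0 + a = (a::'g::monoid_add ext_val)"
  "a + 0 = (a::'g::monoid_add ext_val)"
  by (cases a; simp add: zero_ext_val_def)+

lemma ext_val_add_pos:
  fixes a b :: "'g::linordered_group_add ext_val"
  assumes "0 \<le> a" "0 < b"
  shows "0 < a + b" "0 < b + a"
proof -
  have "0 < g + h \<and> 0 < h + g" if "0 \<le> g" "0 < h" for g h :: 'g
    using that group_add_strict_left_mono[of 0 h g] group_add_strict_right_mono[of 0 h g]
    by (auto intro: le_less_trans)
  then show "0 < a + b" "0 < b + a"
    using assms by (cases a; cases b; auto simp: zero_ext_val_def)+
qed


section \<open>Valued division rings containing the reals\<close>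

text \<open>Covers two situations at once: \<open>v\<close> on the quotient division ring of the
  Weyl algebra, and the extended valuation on the whole ambient division ring.\<close>

locale valued_division_subring =
  fixes K :: "'d::division_ring set" and c :: "real \<Rightarrow> 'd"
    and v :: "'d \<Rightarrow> 'g::linordered_group_add ext_val"
  assumes K_add: "a \<in> K \<Longrightarrow> b \<in> K \<Longrightarrow> a + b \<in> K"
    and K_mult: "a \<in> K \<Longrightarrow> b \<in> K \<Longrightarrow> a * b \<in> K"
    and K_inverse: "a \<in> K \<Longrightarrow> inverse a \<in> K"
    and K_const: "c r \<in> K"
    and c_add: "c (r + s) = c r + c s"
    and c_mult: "c (r * s) = c r * c s"
    and c_1: "c 1 = 1"
    and valuation: "real_valuation_on K c v"
begin

lemma c_0: "c 0 = 0"
  using c_add[of 0 0] by simp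

lemma c_uminus: "c (- r) = - c r"
  using c_add[of "- r" r] c_0 by (simp add: eq_neg_iff_add_eq_0)

lemma v_Infty_iff: "a \<in> K \<Longrightarrow> v a = Infty \<longleftrightarrow> a = 0"
  and v_mult: "a \<in> K \<Longrightarrow> b \<in> K \<Longrightarrow> v (a * b) = v a + v b"
  and v_add: "a \<in> K \<Longrightarrow> b \<in> K \<Longrightarrow> min (v a) (v b) \<le> v (a + b)"
  and v_const: "r \<noteq> 0 \<Longrightarrow> v (c r) = 0"
  using valuation unfolding real_valuation_on_def by blast+

lemma K_1: "1 \<in> K" and K_0: "0 \<in> K"
  using K_const[of 1] K_const[of 0] by (simp_all add: c_1 c_0)

lemma K_uminus: "a \<in> K \<Longrightarrow> - a \<in> K"
  using K_mult[OF K_const[of "- 1"], of a] by (simp add: c_uminus c_1)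

lemma K_diff: "a \<in> K \<Longrightarrow> b \<in> K \<Longrightarrow> a - b \<in> K"
  using K_add[OF _ K_uminus, of a b] by simp

lemma K_power: "a \<in> K \<Longrightarrow> a ^ n \<in> K"
  by (induction n) (auto intro: K_1 K_mult)

lemma K_power_int: "a \<in> K \<Longrightarrow> a powi k \<in> K"
  by (simp add: power_int_def K_power K_inverse)

lemma v_1: "v 1 = 0"
  using v_const[of 1] by (simp add: c_1)

lemma v_0: "v 0 = Infty"
  using v_Infty_iff K_0 by blast

lemma v_uminus: "a \<in> K \<Longrightarrow> v (- a) = v a"
  using v_mult[OF K_const[of "- 1"], of a] v_const[of "- 1"] by (simp add: c_uminus c_1)

lemma v_add_pos:
  assumes "a \<in> K" "b \<in> K" "0 < v a" "0 < v b" shows "0 < v (a + b)"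
  using v_add[of a b] assms by (meson min_less_iff_conj order_less_le_trans)

lemma v_cases:
  assumes "a \<in> K" "a \<noteq> 0" obtains g where "v a = Val g"
  using assms v_Infty_iff by (cases "v a") auto

lemma v_inverse:
  assumes "a \<in> K" "v a = Val g" shows "v (inverse a) = Val (- g)"
proof -
  have "a \<noteq> 0" using assms v_0 by auto
  then have "v a + v (inverse a) = 0"
    using v_mult[of a "inverse a"] assms K_inverse v_1 by simp
  then show ?thesis
    using assms(2) by (cases "v (inverse a)") (auto simp: zero_ext_val_def eq_neg_iff_add_eq_0 minus_unique)
qed

lemma v_power: "a \<in> K \<Longrightarrow> v a = Val g \<Longrightarrow> v (a ^ n) = Val (nat_mult n g)"
  by (induction n) (auto simp: v_1 v_mult K_power zero_ext_val_def)

lemma v_power_int: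
  assumes "a \<in> K" "v a = Val g" shows "v (a powi k) = Val (int_mult k g)"
proof (cases "0 \<le> k")
  case True
  then show ?thesis using v_power[OF assms] by (simp add: power_int_def int_mult_def)
next
  case False
  have "v (inverse a ^ nat (- k)) = Val (nat_mult (nat (- k)) (- g))"
    using v_power[OF K_inverse v_inverse] assms by blast
  then show ?thesis using False by (simp add: power_int_def int_mult_def nat_mult_uminus)
qed

text \<open>Conjugation may change a value when the value group is noncommutative, but it preserves
  the order and fixes \<open>0\<close>, hence preserves positivity.\<close>

lemma v_conjugate_pos:
  assumes "s \<in> K" "s \<noteq> 0" "a \<in> K" "0 < v a"
  shows "0 < v (s * a * inverse s)"
proof -
  obtain g where g: "v s = Val g" using v_cases assms by blast
  have eq: "v (s * a * inverse s) = Val g + v a + Val (- g)"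
    using assms g v_inverse by (simp add: v_mult K_mult K_inverse)
  show ?thesis
  proof (cases "v a")
    case (Val h)
    then have "0 < h" using assms by (simp add: zero_ext_val_def)
    then have "g + 0 + - g < g + h + - g"
      by (intro group_add_strict_right_mono group_add_strict_left_mono)
    then show ?thesis using Val by (simp add: eq zero_ext_val_def)
  qed (simp add: eq zero_ext_val_def)
qed

lemma v_power_int_cancel:
  assumes "a \<in> K" "b \<in> K" "a \<noteq> 0" "b \<noteq> 0" "0 < n" "v (a powi n) = v (b powi n)"
  shows "v a = v b"
proof -
  obtain g h where gh: "v a = Val g" "v b = Val h"
    using v_cases assms by metis
  then have "int_mult n g = int_mult n h"
    using assms v_power_int[of a g n] v_power_int[of b h n] by simp
  then show ?thesis using gh int_mult_cancel assms by simp
qed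

section \<open>Congruence to a real constant: \<open>0 < v (a - c r)\<close> as a working form of
  "\<open>a\<close> has residue \<open>r\<close>"\<close>

lemma near_const_value:
  assumes "a \<in> K" "0 < v (a - c r)"
  shows "0 \<le> v a" "r \<noteq> 0 \<Longrightarrow> v a = 0"
proof -
  have c: "0 \<le> v (c r)"
    by (cases "r = 0") (simp_all add: v_const c_0 v_0)
  show nn: "0 \<le> v a"
    using v_add[of "a - c r" "c r"] c assms K_diff K_const by (simp add: min_def split: if_splits)
  show "v a = 0" if "r \<noteq> 0"
  proof (rule ccontr)
    assume "v a \<noteq> 0"
    then have "0 < v a" using nn by simp
    \<comment> \<open>This difference is \<open>c r\<close>, which has value
      \<open>0\<close>.\<close>
    then have "0 < v (a - (a - c r))"
      using v_add_pos[of a "- (a - c r)"] v_uminus[of "a - c r"] assms K_diff K_const K_uminus by simp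
    then show False using v_const[OF that] by simp
  qed
qed

lemma residue_class_eqI:
  assumes "a \<in> K" "0 < v (a - c r)"
  shows "residue_class K v a = residue_class K v (c r)"
proof -
  have "0 < v (b - y)" if "0 < v (b - x)" "0 < v (x - y)" "b \<in> K" "x \<in> K" "y \<in> K" for b x y
    using v_add_pos[of "b - x" "x - y"] that K_diff by simp
  moreover have "0 < v (c r - a)"
    using v_uminus[of "a - c r"] assms K_diff K_const by simp
  ultimately show ?thesis
    unfolding residue_class_def using assms K_const by blast
qed

text \<open>Injectivity of the natural map from the reals to the residue ring makes the description
  in \<open>residue\<close> unique.\<close>

lemma residue_eqI:
  assumes "residue_field_real K c v" "a \<in> K" "0 < v (a - c r)"
  shows "residue K c v a = r"
  unfolding residue_def
proof (rule the_equality)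
  show "residue_class K v a = residue_class K v (c r)" by (rule residue_class_eqI) fact+
next
  fix s assume "residue_class K v a = residue_class K v (c s)"
  then have "residue_class K v (c s) = residue_class K v (c r)"
    using residue_class_eqI assms by simp
  then show "s = r"
    using assms(1) unfolding residue_field_real_def bij_betw_def inj_on_def by blast
qed

text \<open>This is the surjectivity of the natural map; \<open>a\<close> itself witnesses that two
  equal residue classes give a congruence.\<close>

lemma residue_exists:
  assumes "residue_field_real K c v" "a \<in> K" "0 \<le> v a"
  obtains r where "0 < v (a - c r)"
proof -
  have "residue_class K v a \<in> residue_ring K v"
    unfolding residue_ring_def using assms by blast
  then obtain r where r: "residue_class K v a = residue_class K v (c r)"
    using assms(1) unfolding residue_field_real_def bij_betw_def by blast
  have "a \<in> residue_class K v a"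
    using assms v_0 by (simp add: residue_class_def zero_ext_val_def)
  then have "a \<in> residue_class K v (c r)" using r by simp
  then show thesis by (intro that[of r]) (simp add: residue_class_def)
qed

lemma near_mult:
  assumes "a \<in> K" "b \<in> K" "0 < v (a - c r)" "0 < v (b - c s)"
  shows "0 < v (a * b - c (r * s))"
proof -
  have cr: "0 \<le> v (c r)" by (cases "r = 0") (simp_all add: v_const c_0 v_0)
  have "a * b - c (r * s) = (a - c r) * b + c r * (b - c s)"
    by (simp add: c_mult algebra_simps)
  moreover have "0 < v ((a - c r) * b)"
    using ext_val_add_pos(2)[OF near_const_value(1) assms(3)] assms K_diff K_const
    by (simp add: v_mult)
  moreover have "0 < v (c r * (b - c s))"
    using ext_val_add_pos(1)[OF cr assms(4)] assms K_diff K_const by (simp add: v_mult)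
  ultimately show ?thesis
    using v_add_pos assms K_diff K_const K_mult by metis
qed

lemma near_inverse:
  assumes "a \<in> K" "0 < v (a - c r)" "r \<noteq> 0"
  shows "0 < v (inverse a - c (inverse r))"
proof -
  have va: "v a = 0" using near_const_value(2) assms by blast
  then have "a \<noteq> 0" using v_0 by (auto simp: zero_ext_val_def)
  have cinv: "c r * c (inverse r) = 1" using assms c_mult[of r "inverse r"] c_1 by simp
  have "inverse a - c (inverse r) = inverse a * (- (a - c r)) * c (inverse r)"
  proof -
    have "inverse a * (- (a - c r)) * c (inverse r)
        = inverse a * (c r * c (inverse r)) - (inverse a * a) * c (inverse r)"
      by (simp only: minus_diff_eq right_diff_distrib left_diff_distrib mult.assoc)
    then show ?thesis using \<open>a \<noteq> 0\<close> by (simp add: cinv)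
  qed
  moreover have "v (inverse a) = 0" using v_inverse[of a 0] assms va by (simp add: zero_ext_val_def)
  moreover have "v (- (a - c r)) = v (a - c r)" using assms K_diff K_const by (intro v_uminus) auto
  moreover have "v (c (inverse r)) = 0" using assms by (intro v_const) simp
  moreover have "inverse a \<in> K" "- (a - c r) \<in> K"
    using assms by (simp_all only: K_inverse K_uminus K_diff K_const)
  ultimately show ?thesis using assms(2) by (simp only: v_mult K_mult K_const ext_val_zero_add)
qed

section \<open>Rational values in lowest terms\<close>

lemma v_power_int_cong:
  assumes "a \<in> K" "b \<in> K" "a \<noteq> 0" "b \<noteq> 0" "v a = v b"
  shows "v (a powi k) = v (b powi k)"
proof -
  obtain g where "v a = Val g" using v_cases assms by metis
  then show ?thesis using assms v_power_int by simp
qed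

text \<open>A totally ordered group is torsion-free; a negative exponent is turned into a positive
  one by inversion.\<close>

lemma v_power_int_0:
  assumes "a \<in> K" "a \<noteq> 0" "v (a powi k) = 0" "k \<noteq> 0"
  shows "v a = 0"
proof -
  have *: "v a = 0" if "v (a powi j) = 0" "0 < j" for j
    using v_power_int_cancel[OF assms(1) K_1 assms(2) _ that(2)] that v_1 by simp
  have "v (a powi (- k)) = 0"
    using v_inverse[OF K_power_int[OF assms(1)], of k 0] assms(3)
    by (simp add: power_int_minus zero_ext_val_def)
  then show ?thesis using *[of k] *[of "- k"] assms(3,4) by (cases "0 < k") auto
qed

text \<open>Restates the equation between multiples of values as an equation between values of
  powers, which the extension can later compare with true roots of \<open>x\<close>.\<close>

lemma lowest_terms_value_powi:
  assumes "a \<in> K" "x \<in> K" "lowest_terms_value v x a m n"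
  shows "a \<noteq> 0" "x \<noteq> 0" "v (a powi n) = v (x powi (- m))"
proof -
  obtain g e where ge: "v a = Val g" "v x = Val e" "int_mult n g = int_mult m (- e)"
    using assms(3) unfolding lowest_terms_value_def by blast
  then show "a \<noteq> 0" "x \<noteq> 0" using v_0 by auto
  show "v (a powi n) = v (x powi (- m))"
    using ge assms by (simp add: v_power_int int_mult_uminus)
qed

text \<open>Makes the descriptions \<open>value_num\<close> and \<open>value_den\<close> well
  defined.\<close>

lemma lowest_terms_value_unique:
  assumes "a \<in> K" "x \<in> K" "v x \<noteq> 0"
    and mn: "lowest_terms_value v x a m n" and mn': "lowest_terms_value v x a m' n'"
  shows "m = m'" "n = n'"
proof -
  note p = lowest_terms_value_powi[OF assms(1,2) mn]
  note p' = lowest_terms_value_powi[OF assms(1,2) mn']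
  have pos: "0 < n" "0 < n'" "coprime m n" "coprime m' n'"
    using mn mn' unfolding lowest_terms_value_def by auto
  have raise: "v (a powi (n * k)) = v (x powi (- m * k))"
    if "v (a powi n) = v (x powi (- m))" for m n k
    unfolding power_int_mult
    by (rule v_power_int_cong[OF _ _ _ _ that]) (use assms K_power_int p(1,2) in simp_all)
  \<comment> \<open>Both sides are the value of \<open>a\<close> raised to \<open>n * n'\<close>.
    The quotient of the two powers of \<open>x\<close> then has value \<open>0\<close>, which forces
    its exponent to vanish because \<open>v x\<close> is nonzero.\<close>
  have "v (x powi (- m * n')) = v (x powi (- m' * n))"
    using raise[OF p(3), of n'] raise[OF p'(3), of n] by (simp add: mult.commute)
  moreover obtain e where "v x = Val e" using v_cases assms(2) p(2) by blast
  ultimately have "v (x powi (- m * n') * inverse (x powi (- m' * n))) = 0"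
    using assms(2) v_power_int[of x e] v_inverse[of "x powi (- m' * n)"]
    by (simp add: v_mult K_power_int K_inverse zero_ext_val_def)
  moreover have "x powi (- m * n') * inverse (x powi (- m' * n)) = x powi (- m * n' - (- m' * n))"
    using power_int_add[of x "- m * n' - (- m' * n)" "- m' * n"] p(2) by (simp add: mult.assoc)
  ultimately have "- m * n' - (- m' * n) = 0"
    using v_power_int_0[OF assms(2) p(2), of "- m * n' - (- m' * n)"] assms(3) by argo
  then have eq: "m * n' = m' * n" by simp
  then have "n dvd m * n'" "n' dvd m' * n" using dvd_triv_right[of n m'] dvd_triv_right[of n' m] by auto
  then have "n dvd n'" "n' dvd n"
    using pos by (simp_all add: coprime_commute coprime_dvd_mult_right_iff)
  then show "n = n'" using pos by (simp add: zdvd_antisym_nonneg)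
  then show "m = m'" using eq pos by simp
qed

end


section \<open>Leading terms\<close>

locale weyl_embedding =
  fixes \<iota> :: "puiseux skew_poly \<Rightarrow> 'd::division_ring"
  assumes quotient: "is_quotient_division_ring \<iota>"
begin

abbreviation rc :: "real \<Rightarrow> 'd" where "rc r \<equiv> \<iota> (real_const r)"

lemma iota_add: "\<iota> (a + b) = \<iota> a + \<iota> b"
  and iota_mult: "\<iota> (a * b) = \<iota> a * \<iota> b"
  and iota_1: "\<iota> 1 = 1"
  and iota_inj: "inj \<iota>"
  using quotient unfolding is_quotient_division_ring_def by blast+

lemma iota_0: "\<iota> 0 = 0"
  using iota_add[of 0 0] by simp

lemma iota_eq_0_iff: "\<iota> a = 0 \<longleftrightarrow> a = 0"
  using iota_inj iota_0 by (metis injD)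

section \<open>The fractions of Weyl algebra elements form a division subring\<close>

lemma weyl_quotientI: "a \<in> weyl_algebra \<Longrightarrow> b \<in> weyl_algebra \<Longrightarrow> b \<noteq> 0 \<Longrightarrow>
    \<iota> a * inverse (\<iota> b) \<in> weyl_quotient \<iota>"
  unfolding weyl_quotient_def by blast

lemma weyl_quotientE:
  assumes "z \<in> weyl_quotient \<iota>"
  obtains a b where "a \<in> weyl_algebra" "b \<in> weyl_algebra" "b \<noteq> 0" "z = \<iota> a * inverse (\<iota> b)"
  using assms unfolding weyl_quotient_def by blast

lemma weyl_quotient_iota: "a \<in> weyl_algebra \<Longrightarrow> \<iota> a \<in> weyl_quotient \<iota>"
  using weyl_quotientI[OF _ weyl_algebra_1] by (simp add: iota_1)

lemma right_Ore:
  assumes "a \<in> weyl_algebra" "b \<in> weyl_algebra" "b \<noteq> 0"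
  obtains p q where "p \<in> weyl_algebra" "q \<in> weyl_algebra" "p \<noteq> 0" "\<iota> a * \<iota> p = \<iota> b * \<iota> q"
proof -
  have "x = 0 \<or> y = 0" if "x * y = 0" for x y :: "puiseux skew_poly"
    using that iota_mult[of x y] by (simp add: iota_0 iota_eq_0_iff)
  from weyl_algebra_right_Ore[OF this assms] show thesis
    using that by (metis iota_mult)
qed

text \<open>The Ore condition applied to the two denominators supplies a common one,
  \<open>b * p\<close>.\<close>

lemma weyl_quotient_add:
  assumes "z \<in> weyl_quotient \<iota>" "z' \<in> weyl_quotient \<iota>"
  shows "z + z' \<in> weyl_quotient \<iota>"
proof -
  obtain a b where ab: "a \<in> weyl_algebra" "b \<in> weyl_algebra" "b \<noteq> 0" "z = \<iota> a * inverse (\<iota> b)"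
    using assms(1) by (rule weyl_quotientE)
  obtain a' b' where ab': "a' \<in> weyl_algebra" "b' \<in> weyl_algebra" "b' \<noteq> 0"
    "z' = \<iota> a' * inverse (\<iota> b')"
    using assms(2) by (rule weyl_quotientE)
  obtain p q where pq: "p \<in> weyl_algebra" "q \<in> weyl_algebra" "p \<noteq> 0" "\<iota> b * \<iota> p = \<iota> b' * \<iota> q"
    using right_Ore[OF ab(2) ab'(2,3)] by blast
  have nz: "\<iota> b \<noteq> 0" "\<iota> b' \<noteq> 0" "\<iota> p \<noteq> 0" using ab ab' pq by (simp_all add: iota_eq_0_iff)
  then have q: "\<iota> q \<noteq> 0" using pq(4) by (metis mult_eq_0_iff)
  have "z = \<iota> (a * p) * inverse (\<iota> (b * p))"
    using nz by (simp add: ab(4) iota_mult nonzero_inverse_mult_distrib mult.assoc)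
      (simp flip: mult.assoc)
  moreover have "z' = \<iota> (a' * q) * inverse (\<iota> (b * p))"
    using nz q by (simp add: ab'(4) iota_mult pq(4) nonzero_inverse_mult_distrib mult.assoc)
      (simp flip: mult.assoc)
  ultimately have "z + z' = \<iota> (a * p + a' * q) * inverse (\<iota> (b * p))"
    by (simp add: iota_add distrib_right)
  moreover have "b * p \<noteq> 0" using nz by (metis iota_eq_0_iff iota_mult mult_eq_0_iff)
  ultimately show ?thesis
    using ab ab' pq by (auto intro!: weyl_quotientI weyl_algebra.add weyl_algebra.mult)
qed

text \<open>The Ore condition rewrites the inner left fraction with denominator \<open>b\<close> and
  numerator \<open>a'\<close> as a right fraction with numerator \<open>q\<close> and denominator
  \<open>p\<close>.\<close>

lemma weyl_quotient_mult:
  assumes "z \<in> weyl_quotient \<iota>" "z' \<in> weyl_quotient \<iota>"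
  shows "z * z' \<in> weyl_quotient \<iota>"
proof -
  obtain a b where ab: "a \<in> weyl_algebra" "b \<in> weyl_algebra" "b \<noteq> 0" "z = \<iota> a * inverse (\<iota> b)"
    using assms(1) by (rule weyl_quotientE)
  obtain a' b' where ab': "a' \<in> weyl_algebra" "b' \<in> weyl_algebra" "b' \<noteq> 0"
    "z' = \<iota> a' * inverse (\<iota> b')"
    using assms(2) by (rule weyl_quotientE)
  obtain p q where pq: "p \<in> weyl_algebra" "q \<in> weyl_algebra" "p \<noteq> 0" "\<iota> a' * \<iota> p = \<iota> b * \<iota> q"
    using right_Ore[OF ab'(1) ab(2,3)] by blast
  have nz: "\<iota> b \<noteq> 0" "\<iota> b' \<noteq> 0" "\<iota> p \<noteq> 0" using ab ab' pq by (simp_all add: iota_eq_0_iff)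
  have "inverse (\<iota> b) * \<iota> a' = inverse (\<iota> b) * (\<iota> a' * \<iota> p) * inverse (\<iota> p)"
    using nz by (simp add: mult.assoc)
  also have "\<dots> = \<iota> q * inverse (\<iota> p)"
    using nz unfolding pq(4) by (simp flip: mult.assoc)
  finally have "z * z' = \<iota> a * (\<iota> q * inverse (\<iota> p)) * inverse (\<iota> b')"
    by (metis ab(4) ab'(4) mult.assoc)
  also have "\<dots> = \<iota> (a * q) * inverse (\<iota> (b' * p))"
    using nz by (simp add: iota_mult nonzero_inverse_mult_distrib mult.assoc)
  finally have "z * z' = \<iota> (a * q) * inverse (\<iota> (b' * p))" .
  moreover have "b' * p \<noteq> 0" using nz by (metis iota_eq_0_iff iota_mult mult_eq_0_iff)
  ultimately show ?thesis
    using ab ab' pq by (auto intro!: weyl_quotientI weyl_algebra.mult)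
qed

lemma weyl_quotient_inverse:
  assumes "z \<in> weyl_quotient \<iota>" shows "inverse z \<in> weyl_quotient \<iota>"
proof -
  obtain a b where ab: "a \<in> weyl_algebra" "b \<in> weyl_algebra" "b \<noteq> 0" "z = \<iota> a * inverse (\<iota> b)"
    using assms by (rule weyl_quotientE)
  show ?thesis
  proof (cases "a = 0")
    case True
    then show ?thesis using ab weyl_quotient_iota[OF weyl_algebra_0] by (simp add: iota_0)
  next
    case False
    then have "inverse z = \<iota> b * inverse (\<iota> a)"
      using ab by (simp add: iota_eq_0_iff nonzero_inverse_mult_distrib)
    then show ?thesis using ab False by (simp add: weyl_quotientI)
  qed
qed

lemma rc_add: "rc (r + s) = rc r + rc s" and rc_mult: "rc (r * s) = rc r * rc s"
  and rc_1: "rc 1 = 1"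
  by (simp_all add: real_const_hom iota_add iota_mult iota_1)

text \<open>\<open>T q\<close> is the image of \<open>x\<close> to the power \<open>q\<close>.\<close>

definition T :: "rat \<Rightarrow> 'd" where
  "T q = \<iota> (skew_const (puiseux_monom (- q) 1))"

lemma T_add: "T (p + q) = T p * T q"
  by (simp add: T_def puiseux_monom_mult flip: iota_mult skew_const_mult)

lemma T_0: "T 0 = 1"
  by (simp add: T_def puiseux_monom_one skew_const_1 iota_1)

lemma T_1: "T 1 = X \<iota>"
  by (simp add: T_def X_def x_elem_def)

lemma T_nonzero: "T q \<noteq> 0"
  using T_add[of q "- q"] T_0 by auto

lemma inverse_T: "inverse (T q) = T (- q)"
  using T_add[of q "- q"] T_0 by (auto intro: inverse_unique)

lemma T_powi: "T q powi k = T (of_int k * q)"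
proof -
  have pow: "T q ^ n = T (of_nat n * q)" for n q
    by (induction n) (auto simp: T_0 T_add distrib_right)
  show ?thesis by (simp add: power_int_def pow inverse_T)
qed

lemma T_rc_commute: "T q * rc r = rc r * T q"
  by (simp add: T_def real_const_def mult.commute flip: iota_mult skew_const_mult)

end

text \<open>The extension \<open>w\<close> may have its own, larger value group;
  \<open>\<phi>\<close> is the order embedding of the value group of \<open>v\<close> into
  it.\<close>

locale weyl_valuation_extension = weyl_embedding \<iota>
  for \<iota> :: "puiseux skew_poly \<Rightarrow> 'd::division_ring" +
  fixes v :: "'d \<Rightarrow> 'g::linordered_group_add ext_val"
    and w :: "'d \<Rightarrow> 'h::linordered_group_add ext_val"
    and \<phi> :: "'g \<Rightarrow> 'h"
  assumes v_valuation: "real_valuation_on (weyl_quotient \<iota>) (\<lambda>r. \<iota> (real_const r)) v"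
    and v_residue: "residue_field_real (weyl_quotient \<iota>) (\<lambda>r. \<iota> (real_const r)) v"
    and v_x: "v (\<iota> x_elem) < 0"
    and w_valuation: "real_valuation_on UNIV (\<lambda>r. \<iota> (real_const r)) w"
    and w_residue: "residue_field_real UNIV (\<lambda>r. \<iota> (real_const r)) w"
    and \<phi>_embedding: "strict_mono \<phi>" "\<And>a b. \<phi> (a + b) = \<phi> a + \<phi> b"
    and w_extends: "\<And>a. a \<in> weyl_quotient \<iota> \<Longrightarrow> w a = map_ext_val \<phi> (v a)"
begin

sublocale V: valued_division_subring "weyl_quotient \<iota>" rc v
  by unfold_locales
    (auto simp: weyl_quotient_add weyl_quotient_mult weyl_quotient_inverse rc_add rc_mult rc_1
      v_valuation intro: weyl_quotient_iota weyl_algebra.const)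

sublocale W: valued_division_subring UNIV rc w
  by unfold_locales (auto simp: rc_add rc_mult rc_1 w_valuation)

text \<open>Carries congruences found with \<open>w\<close> back to \<open>v\<close>, with respect
  to which \<open>res\<close> is defined.\<close>

lemma w_pos_iff:
  assumes "a \<in> weyl_quotient \<iota>" shows "0 < w a \<longleftrightarrow> 0 < v a"
proof -
  have "\<phi> 0 = 0" using \<phi>_embedding(2)[of 0 0] by (metis add.right_neutral add_left_cancel)
  then have "0 < \<phi> g \<longleftrightarrow> 0 < g" for g
    using strict_mono_less[OF \<phi>_embedding(1), of 0 g] by simp
  then show ?thesis using w_extends[OF assms] by (cases "v a") (auto simp: zero_ext_val_def)
qed

text \<open>\<open>a = x\<^sup>q u\<close> for a unit \<open>u\<close> with residue \<open>r\<close>.\<close>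

definition leading :: "'d \<Rightarrow> rat \<Rightarrow> real \<Rightarrow> bool" where
  "leading a q r \<longleftrightarrow> r \<noteq> 0 \<and> 0 < w (T (- q) * a - rc r)"

lemma T_conjugate_near:
  assumes "0 < w (a - rc r)" shows "0 < w (T q * a * T (- q) - rc r)"
proof -
  have "T q * rc r * T (- q) = rc r"
    using T_add[of q "- q"] by (simp add: T_rc_commute T_0 mult.assoc)
  then have "T q * a * T (- q) - rc r = T q * (a - rc r) * inverse (T q)"
    by (simp add: inverse_T algebra_simps)
  then show ?thesis using W.v_conjugate_pos[of "T q" "a - rc r"] assms T_nonzero by simp
qed

text \<open>Moving the power of \<open>x\<close> in \<open>b\<close> to the front conjugates the
  unit part of \<open>a\<close> to \<open>u\<close>, which by \<open>T_conjugate_near\<close> has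
  the same residue.\<close>

lemma leading_mult:
  assumes "leading a q r" "leading b p s" shows "leading (a * b) (q + p) (r * s)"
proof -
  define u where "u = T (- p) * (T (- q) * a) * T p"
  have u: "0 < w (u - rc r)"
    using T_conjugate_near[of "T (- q) * a" r "- p"] assms(1) by (simp add: u_def leading_def)
  have "T (- (q + p)) = T (- p) * T (- q)" using T_add[of "- p" "- q"] by (simp add: add.commute)
  moreover have "T p * T (- p) = 1" using T_add[of p "- p"] T_0 by simp
  then have "T p * (T (- p) * b) = b" by (metis mult.assoc mult_1)
  ultimately have "T (- (q + p)) * (a * b) = u * (T (- p) * b)"
    by (simp add: u_def mult.assoc)
  then show ?thesis
    using W.near_mult[OF _ _ u, of "T (- p) * b" s] assms by (simp add: leading_def)
qed

text \<open>Inversion puts the power of \<open>x\<close> on the right of the unit; bringing it to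
  the left is again a conjugation, harmless for the residue.\<close>

lemma leading_inverse:
  assumes "leading a q r" shows "leading (inverse a) (- q) (inverse r)"
proof -
  define u where "u = T (- q) * a"
  have u: "0 < w (u - rc r)" "r \<noteq> 0" using assms by (simp_all add: u_def leading_def)
  have "u \<noteq> 0" using W.near_const_value(2)[OF _ u] W.v_0 by (auto simp: zero_ext_val_def)
  moreover have "T q * T (- q) = 1" using T_add[of q "- q"] T_0 by simp
  then have "a = T q * u" unfolding u_def by (metis mult.assoc mult_1)
  ultimately have "inverse a = inverse u * T (- q)"
    using T_nonzero by (simp add: nonzero_inverse_mult_distrib inverse_T)
  moreover have "0 < w (T q * inverse u * T (- q) - rc (inverse r))"
    using u by (intro T_conjugate_near W.near_inverse) auto
  ultimately show ?thesis using u by (simp add: leading_def mult.assoc)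
qed

lemma leading_power_int:
  assumes "leading a q r" shows "leading (a powi k) (of_int k * q) (r powi k)"
proof -
  have one: "leading 1 0 1" using W.v_0 by (simp add: leading_def T_0 rc_1 zero_ext_val_def)
  have pow: "leading (b ^ n) (of_nat n * p) (s ^ n)" if "leading b p s" for b p s n
  proof (induction n)
    case (Suc n)
    show ?case using leading_mult[OF that Suc] by (simp add: distrib_right)
  qed (simp add: one)
  show ?thesis
    using pow[OF assms, of "nat k"] pow[OF leading_inverse[OF assms], of "nat (- k)"]
    by (cases "0 \<le> k") (simp_all add: power_int_def)
qed

lemma leading_X: "leading (X \<iota>) 1 1"
  using T_add[of "- 1" 1] W.v_0 by (simp add: leading_def T_0 T_1 rc_1 zero_ext_val_def)

lemma X_in_weyl_quotient: "X \<iota> \<in> weyl_quotient \<iota>"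
  by (simp add: X_def weyl_quotient_iota weyl_algebra.x)

lemma leading_res:
  assumes "a \<in> weyl_quotient \<iota>" "leading a 0 r" shows "res \<iota> v a = r"
  unfolding res_def
proof (rule V.residue_eqI[OF v_residue assms(1)])
  have "a - rc r \<in> weyl_quotient \<iota>" using assms(1) V.K_diff V.K_const by blast
  then show "0 < v (a - rc r)"
    using assms(2) w_pos_iff by (simp add: leading_def T_0)
qed

text \<open>Here the extension is essential: it contains the fractional power \<open>t\<close> of
  \<open>x\<close>, and its residue field is still the reals. Uniqueness of roots in the value group
  gives \<open>t * a\<close> the value \<open>0\<close>, so it has a nonzero real residue.\<close>

lemma leading_exists:
  assumes "a \<in> weyl_quotient \<iota>" "lowest_terms_value v (X \<iota>) a m n"
  obtains r where "leading a (- (of_int m / of_int n)) r"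
proof -
  define t where "t = T (of_int m / of_int n)"
  have n: "0 < n" using assms(2) by (simp add: lowest_terms_value_def)
  note powi = V.lowest_terms_value_powi[OF assms(1) X_in_weyl_quotient assms(2)]
  have "inverse t powi n = T (of_int (- m))"
    using n by (simp add: t_def inverse_T T_powi)
  also have "\<dots> = X \<iota> powi (- m)" by (simp add: T_powi flip: T_1)
  finally have "w (a powi n) = w (inverse t powi n)"
    using powi(3) assms(1) by (simp add: w_extends V.K_power_int X_in_weyl_quotient)
  then have "w a = w (inverse t)"
    using W.v_power_int_cancel[of a "inverse t" n] n powi(1) T_nonzero by (simp add: t_def)
  then have "w (t * a) = w (t * inverse t)" by (simp add: W.v_mult)
  then have 0: "w (t * a) = 0" using T_nonzero W.v_1 by (simp add: t_def)
  then obtain r where r: "0 < w (t * a - rc r)"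
    using W.residue_exists[OF w_residue, of "t * a"] by auto
  moreover have "r \<noteq> 0" using r 0 W.c_0 by auto
  ultimately show thesis using that by (simp add: leading_def t_def)
qed

section \<open>Leading terms along the associated sequence\<close>

lemma omega_in_weyl_quotient: "omega \<iota> v i \<in> weyl_quotient \<iota>"
proof (induction i rule: omega.induct)
  case (3 i)
  then show ?case
    using X_in_weyl_quotient
    by (auto simp: unit_of_def intro!: V.K_diff V.K_mult V.K_power_int V.K_const)
qed (auto simp: X_in_weyl_quotient intro: weyl_quotient_iota weyl_algebra.y)

lemma omega_lowest_terms:
  assumes "in_range \<iota> v i" "0 < i"
  shows "lowest_terms_value v (X \<iota>) (omega \<iota> v i) (num \<iota> v i) (den \<iota> v i)"
proof -
  obtain m n where mn: "lowest_terms_value v (X \<iota>) (omega \<iota> v i) m n"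
    using assms unfolding in_range_def rational_value_def by blast
  have vX: "v (X \<iota>) \<noteq> 0" using v_x by (simp add: X_def)
  note unique = V.lowest_terms_value_unique[OF omega_in_weyl_quotient X_in_weyl_quotient vX _ mn]
  have "value_num \<iota> v (omega \<iota> v i) = m" "value_den \<iota> v (omega \<iota> v i) = n"
    unfolding value_num_def value_den_def using mn unique by (blast intro: the_equality)+
  then show ?thesis using mn assms(2) by (simp add: num_def den_def)
qed

lemma num_den_coprime:
  assumes "in_range \<iota> v i" shows "coprime (num \<iota> v i) (den \<iota> v i)" "den \<iota> v i \<noteq> 0"
proof -
  have "coprime (num \<iota> v i) (den \<iota> v i) \<and> den \<iota> v i \<noteq> 0"
  proof (cases "i = 0")
    case True
    then show ?thesis by (simp add: num_def den_def)
  next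
    case False
    then show ?thesis using omega_lowest_terms[OF assms] by (auto simp: lowest_terms_value_def)
  qed
  then show "coprime (num \<iota> v i) (den \<iota> v i)" "den \<iota> v i \<noteq> 0" by auto
qed

lemma omega_leading:
  assumes "in_range \<iota> v i"
  obtains r where "leading (omega \<iota> v i) (- (of_int (num \<iota> v i) / of_int (den \<iota> v i))) r"
proof (cases "i = 0")
  case True
  \<comment> \<open>The convention \<open>num = 1\<close>, \<open>den = - 1\<close> at index 0 gives
    the exponent 1 of \<open>X\<close>, so one formula serves all indices.\<close>
  then show ?thesis using that leading_X by (simp add: num_def den_def)
next
  case False
  then show ?thesis
    using that leading_exists[OF omega_in_weyl_quotient omega_lowest_terms[OF assms]] by blast
qed

text \<open>The power of \<open>X\<close> cancels the exponent of the power of \<open>omega\<close>,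
  and \<open>X\<close> itself has leading coefficient 1.\<close>

lemma beta_eq:
  assumes "in_range \<iota> v i" "leading (omega \<iota> v i) (- (of_int (num \<iota> v i) / of_int (den \<iota> v i))) r"
  shows "beta \<iota> v i = r powi den \<iota> v i"
  unfolding beta_def
proof (rule leading_res)
  show "X \<iota> powi num \<iota> v i * omega \<iota> v i powi den \<iota> v i \<in> weyl_quotient \<iota>"
    by (intro V.K_mult V.K_power_int X_in_weyl_quotient omega_in_weyl_quotient)
  show "leading (X \<iota> powi num \<iota> v i * omega \<iota> v i powi den \<iota> v i) 0 (r powi den \<iota> v i)"
    using leading_mult[OF leading_power_int[OF leading_X, of "num \<iota> v i"]
        leading_power_int[OF assms(2), of "den \<iota> v i"]] num_den_coprime(2)[OF assms(1)]
    by simp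
qed

end


section \<open>Signs and parities\<close>

lemma power_int_even_pos:
  fixes r :: real
  assumes "even k" "r \<noteq> 0" shows "0 < r powi k"
proof -
  obtain l where "k = l * 2" using assms(1) by (metis dvd_def mult.commute)
  then have "r powi k = (r powi l)\<^sup>2" by (simp add: power_int_mult)
  then show ?thesis using assms by simp
qed

lemma power_int_odd_sign:
  fixes r :: real
  assumes "odd k" "r \<noteq> 0" shows "0 < r powi k * r"
proof -
  have "r powi k * r = r powi (k + 1)" using assms by (simp add: power_int_add)
  then show ?thesis using assms power_int_even_pos[of "k + 1" r] by simp
qed

text \<open>With \<open>h\<close> the 2-adic order of \<open>n\<close>, the gcd is
  \<open>2 ^ h\<close> times a divisor \<open>g\<close> of the odd number \<open>m' * u\<close>.
  Division by the odd \<open>g\<close> keeps parity, and \<open>n'\<close> retains a factor 2 beyond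
  \<open>2 ^ h\<close>. Oddness of \<open>m'\<close> comes from coprimality with the even
  \<open>n'\<close>.\<close>

lemma reduced_fraction_parity:
  fixes m n m' n' :: int
  assumes "multiplicity 2 n < multiplicity 2 n'" "n \<noteq> 0" "coprime m' n'" "n' \<noteq> 0"
  shows "odd (m' * n div gcd (m' * n) (m * n'))" "even (m * n' div gcd (m * n') (m' * n))"
    "m' * n \<noteq> 0"
proof -
  define h where "h = multiplicity 2 n"
  obtain u where u: "n = 2 ^ h * u" "\<not> 2 dvd u"
    using multiplicity_decompose'[OF assms(2), of 2] unfolding h_def by auto
  have "2 ^ Suc h dvd n'"
    using assms(1) multiplicity_dvd'[of "Suc h" 2 n'] by (simp add: h_def)
  then obtain t where t: "n' = 2 ^ h * (2 * t)" by (auto simp: dvd_def mult.assoc)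
  have m': "odd m'" using assms(3) t by (auto simp: coprime_def)
  define g where "g = gcd (m' * u) (m * (2 * t))"
  have g: "odd g" using m' u(2) unfolding g_def by (meson dvd_trans even_mult_iff gcd_dvd1)
  have "gcd (m' * n) (m * n') = gcd (2 ^ h * (m' * u)) (2 ^ h * (m * (2 * t)))"
    by (simp add: u(1) t ac_simps)
  also have "\<dots> = 2 ^ h * g" unfolding g_def by (subst gcd_mult_distrib_int[symmetric]) simp
  finally have G: "gcd (m' * n) (m * n') = 2 ^ h * g" .
  have "m' * n div gcd (m' * n) (m * n') = (m' * u) div g"
    unfolding G using u(1) by (simp add: mult.left_commute)
  moreover have "g * (m' * u div g) = m' * u" by (simp add: g_def)
  then have "odd (m' * u div g)" using m' u(2) by (metis even_mult_iff)
  ultimately show "odd (m' * n div gcd (m' * n) (m * n'))" by simp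
  have "m * n' div gcd (m * n') (m' * n) = (m * (2 * t)) div g"
    unfolding gcd.commute[of "m * n'"] G using t by (simp add: mult.left_commute)
  moreover have "g * (m * (2 * t) div g) = m * (2 * t)" by (simp add: g_def)
  then have "even (m * (2 * t) div g)" using g by (metis even_mult_iff dvd_triv_left)
  ultimately show "even (m * n' div gcd (m * n') (m' * n))" by simp
  show "m' * n \<noteq> 0" using m' assms(2) by auto
qed

context weyl_valuation_extension
begin

text \<open>The factor coming from \<open>j\<close> occurs with an even exponent and is positive;
  the one from \<open>i\<close> has an odd exponent and keeps the sign of \<open>r\<close>.\<close>

lemma alpha_sign:
  assumes "in_range \<iota> v i" "in_range \<iota> v j" "two_exp \<iota> v i < two_exp \<iota> v j"
    and lead: "leading (omega \<iota> v i) (- (of_int (num \<iota> v i) / of_int (den \<iota> v i))) r"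
  shows "0 < alpha \<iota> v i j * r"
proof -
  let ?m = "num \<iota> v" and ?n = "den \<iota> v" and ?\<omega> = "omega \<iota> v" and ?K = "K_exp \<iota> v"
  obtain s where s: "leading (?\<omega> j) (- (of_int (?m j) / of_int (?n j))) s"
    using omega_leading[OF assms(2)] .
  have n0: "?n i \<noteq> 0" "?n j \<noteq> 0" using num_den_coprime assms(1,2) by blast+
  define G where "G = gcd (?m j * ?n i) (?m i * ?n j)"
  have "multiplicity 2 (?n i) < multiplicity 2 (?n j)" using assms(3) by (simp add: two_exp_def)
  note par = reduced_fraction_parity[OF this n0(1) num_den_coprime(1)[OF assms(2)] n0(2)]
  have odd: "odd (?K i j)" and even: "even (?K j i)"
    using par(1,2)[of "?m i"] by (simp_all add: K_exp_def)
  have G0: "G \<noteq> 0" using par(3) by (simp add: G_def)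
  have KG: "?K i j * G = ?m j * ?n i" "?K j i * G = ?m i * ?n j"
    by (simp_all add: K_exp_def G_def gcd.commute[of "?m i * ?n j"])
  \<comment> \<open>Both sides equal \<open>?m i * ?m j / G\<close>; hence the powers of
    \<open>x\<close> in the two factors of \<open>alpha\<close> cancel.\<close>
  have "of_int (?K i j) * (of_int (?m i) / of_int (?n i) :: rat)
      = of_int (?K j i) * (of_int (?m j) / of_int (?n j))"
  proof -
    have "of_int G * (of_int (?K i j) * (of_int (?m i) / of_int (?n i)) :: rat)
        = of_int (?K i j * G) * of_int (?m i) / of_int (?n i)" by simp
    also have "\<dots> = of_int (?m j) * of_int (?m i)" unfolding KG using n0 by simp
    also have "\<dots> = of_int (?K j i * G) * of_int (?m j) / of_int (?n j)"
      unfolding KG using n0 by simp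
    also have "\<dots> = of_int G * (of_int (?K j i) * (of_int (?m j) / of_int (?n j)))" by simp
    finally show ?thesis using G0 by (metis mult_left_cancel of_int_eq_0_iff)
  qed
  then have "leading (?\<omega> i powi ?K i j * ?\<omega> j powi (- ?K j i)) 0
      (r powi ?K i j * s powi (- ?K j i))"
    using leading_mult[OF leading_power_int[OF lead, of "?K i j"]
        leading_power_int[OF s, of "- ?K j i"]] by simp
  moreover have "?\<omega> i powi ?K i j * ?\<omega> j powi (- ?K j i) \<in> weyl_quotient \<iota>"
    by (intro V.K_mult V.K_power_int omega_in_weyl_quotient)
  \<comment> \<open>The strict inequality of 2-adic orders gives \<open>i \<noteq> j\<close>,
    excluding the default value 1 of \<open>alpha\<close>.\<close>
  ultimately have "alpha \<iota> v i j = r powi ?K i j * s powi (- ?K j i)"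
    using leading_res assms(3) by (auto simp: alpha_def)
  moreover have "0 < r powi ?K i j * r" "0 < s powi (- ?K j i)"
    using lead s odd even by (auto simp: leading_def intro!: power_int_odd_sign power_int_even_pos)
  ultimately show ?thesis
    using mult_pos_pos[of "r powi ?K i j * r" "s powi (- ?K j i)"] by (simp add: mult_ac)
qed

end

theorem proposition4p1:
  fixes \<iota> :: "puiseux skew_poly \<Rightarrow> 'd::division_ring"
    and v :: "'d \<Rightarrow> 'g::linordered_group_add ext_val"
    and w :: "'d \<Rightarrow> 'h::linordered_group_add ext_val"
    and \<phi> :: "'g \<Rightarrow> 'h"
  assumes quotient: "is_quotient_division_ring \<iota>"
    and v_valuation: "real_valuation_on (weyl_quotient \<iota>) (\<lambda>r. \<iota> (real_const r)) v"
    and v_residue: "residue_field_real (weyl_quotient \<iota>) (\<lambda>r. \<iota> (real_const r)) v"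
    and v_x: "v (\<iota> x_elem) < 0"
    and w_valuation: "real_valuation_on UNIV (\<lambda>r. \<iota> (real_const r)) w"
    and w_residue: "residue_field_real UNIV (\<lambda>r. \<iota> (real_const r)) w"
    and \<phi>_embedding: "strict_mono \<phi>" "\<And>a b. \<phi> (a + b) = \<phi> a + \<phi> b"
    and w_extends: "\<And>a. a \<in> weyl_quotient \<iota> \<Longrightarrow> w a = map_ext_val \<phi> (v a)"
  shows "(\<forall>i\<ge>1. in_range \<iota> v i \<and> even (den \<iota> v i) \<longrightarrow> 0 < beta \<iota> v i) \<and>
    (\<forall>i j l. in_range \<iota> v i \<and> in_range \<iota> v j \<and> in_range \<iota> v l \<and>
       two_exp \<iota> v i < two_exp \<iota> v j \<and> two_exp \<iota> v j \<le> two_exp \<iota> v l \<longrightarrow>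
       0 < alpha \<iota> v i j * alpha \<iota> v i l)"
proof -
  interpret weyl_valuation_extension \<iota> v w \<phi>
    by unfold_locales fact+
  show ?thesis
  proof (intro conjI allI impI; elim conjE)
    fix i assume i: "in_range \<iota> v i" "even (den \<iota> v i)"
    obtain r where "leading (omega \<iota> v i) (- (of_int (num \<iota> v i) / of_int (den \<iota> v i))) r"
      using omega_leading i(1) by blast
    then show "0 < beta \<iota> v i"
      using beta_eq i power_int_even_pos by (simp add: leading_def)
  next
    fix i j l
    assume range: "in_range \<iota> v i" "in_range \<iota> v j" "in_range \<iota> v l"
      and h: "two_exp \<iota> v i < two_exp \<iota> v j" "two_exp \<iota> v j \<le> two_exp \<iota> v l"
    obtain r where r: "leading (omega \<iota> v i) (- (of_int (num \<iota> v i) / of_int (den \<iota> v i))) r"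
      using omega_leading range(1) by blast
    \<comment> \<open>Both numbers have the sign of the same \<open>r\<close>, hence equal
      signs.\<close>
    have "0 < alpha \<iota> v i j * r" "0 < alpha \<iota> v i l * r"
      using alpha_sign[OF range(1) _ _ r] range h by auto
    then show "0 < alpha \<iota> v i j * alpha \<iota> v i l"
      by (auto simp: zero_less_mult_iff)
  qed
qed

end
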